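(* Let $\mathcal{V}$ be a separable, infinite dimensional Hilbert space over $\mathbb{K}=\mathbb{R}$ or $\mathbb{C}$ and let $a:\mathcal{V}\times\mathcal{V}\to\mathbb{K}$ be a continuous sesquilinear form. The following assertions are equivalent: (i) the form $a$ is essentially coercive and satisfies uniqueness; (ii) the form $a$ has the universal Galerkin property.
   Context: $\mathbb{N}^*=\{1,2,\dots\}$. A sesquilinear form is linear in the first and antilinear in the second variable (bilinear if $\mathbb{K}=\mathbb{R}$); continuity means $|a(u,v)|\le M\|u\|_{\mathcal{V}}\|v\|_{\mathcal{V}}$ for some $M>0$ and all $u,v$. $\mathcal{V}'$ is the space of continuous antilinear functionals on $\mathcal{V}$ (the usual dual if $\mathbb{K}=\mathbb{R}$), with pairing $\langle L,v\rangle$. The form $a$ is essentially coercive if for each sequence $(u_n)$ in $\mathcal{V}$ converging weakly to $0$ with $\lim_{n\to\infty}a(u_n,u_n)=0$, one has $\lim_{n\to\infty}\|u_n\|_{\mathcal{V}}=0$. The form $a$ satisfies uniqueness if for $u\in\mathcal{V}$, $a(u,v)=0$ for all $v\in\mathcal{V}$ implies $u=0$. An approximating sequence of $\mathcal{V}$ is a sequence $(\mathcal{V}_n)_{n\in\mathbb{N}^*}$ of finite dimensional subspaces of $\mathcal{V}$ (not assumed nested) such that $\mathrm{dist}(v,\mathcal{V}_n):=\inf\{\|v-\chi\|_{\mathcal{V}}:\chi\in\mathcal{V}_n\}\to0$ as $n\to\infty$ for all $v\in\mathcal{V}$. The form $a$ has the universal Galerkin property if for every $L\in\mathcal{V}'$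 there is a unique $u\in\mathcal{V}$ with $a(u,v)=\langle L,v\rangle$ for all $v\in\mathcal{V}$, and the following holds: for every approximating sequence $(\mathcal{V}_n)_{n\in\mathbb{N}^*}$ of $\mathcal{V}$ there exist $n_0\in\mathbb{N}^*$ and $\gamma>0$ such that for each $L\in\mathcal{V}'$ and each $n\ge n_0$ there is a unique $u_n\in\mathcal{V}_n$ with $a(u_n,\chi)=\langle L,\chi\rangle$ for all $\chi\in\mathcal{V}_n$, and $\|u-u_n\|_{\mathcal{V}}\le\gamma\,\mathrm{dist}(u,\mathcal{V}_n)$ for all $n\ge n_0$, where $u$ is the solution of $a(u,v)=\langle L,v\rangle$ for all $v\in\mathcal{V}$. *)

theory Defs
  imports "HOL-Analysis.Analysis"
begin

(* The scalar field K.  The type class covers K = real and K = complex at once, and up to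
   isometric isomorphism respecting the conjugation it has no other models: see the lemma
   scalar_field_cases below. *)
class real_or_complex = real_normed_field +
  fixes kcnj :: "'a \<Rightarrow> 'a"
  assumes kcnj_add: "kcnj (x + y) = kcnj x + kcnj y"
    and mult_kcnj_scaleR: "x * kcnj x = ((norm x)\<^sup>2) *\<^sub>R 1"

lemma mult_kcnj: "x * kcnj x = of_real ((norm x)\<^sup>2)" for x :: "'k::real_or_complex"
  by (simp add: mult_kcnj_scaleR of_real_def)

instantiation real :: real_or_complex
begin
definition kcnj_real_def [simp]: "kcnj (x :: real) = x"
instance by standard (simp_all add: power2_eq_square)
end

instantiation complex :: real_or_complex
begin
definition kcnj_complex_def [simp]: "kcnj (z :: complex) = cnj z"
instance by standard (simp_all add: complex_norm_square[symmetric] scaleR_conv_of_real del: of_real_power)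
end

lemma kcnj_of_real: "kcnj (of_real r :: 'k::real_or_complex) = of_real r"
proof (cases "r = 0")
  case True
  then show ?thesis using kcnj_add[of "0::'k" 0] by simp
next
  case False
  have "of_real r * kcnj (of_real r :: 'k) = of_real r * of_real r"
    using mult_kcnj[of "of_real r :: 'k"] by (simp add: power2_eq_square)
  then show ?thesis using False by simp
qed

lemma add_kcnj: "\<exists>r. (z :: 'k::real_or_complex) + kcnj z = of_real r"
proof -
  have one: "kcnj (1::'k) = 1" using kcnj_of_real[of 1, where 'k='k] by simp
  have "(z + 1) * kcnj (z + 1) = z * kcnj z + z + kcnj z + 1"
    by (simp add: kcnj_add one algebra_simps)
  then have "z + kcnj z = of_real ((norm (z + 1))\<^sup>2 - (norm z)\<^sup>2 - 1)"
    unfolding mult_kcnj by (simp add: algebra_simps)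
  then show ?thesis by blast
qed

lemma scalar_field_cases:
  "(\<forall>z :: 'k::real_or_complex. z \<in> \<real>) \<or>
   (\<exists>\<iota> :: 'k. \<iota> * \<iota> = -1 \<and>
     (\<forall>z. \<exists>a b. z = of_real a + of_real b * \<iota>) \<and>
     (\<forall>a b. norm (of_real a + of_real b * \<iota>) = sqrt (a\<^sup>2 + b\<^sup>2) \<and>
       kcnj (of_real a + of_real b * \<iota>) = of_real a - of_real b * \<iota>))"
proof (cases "\<forall>z :: 'k. z \<in> \<real>")
  case False
  have split: "\<exists>r v. z = of_real r + v \<and> kcnj v = - v" for z :: 'k
  proof -
    obtain s where s: "z + kcnj z = of_real s" using add_kcnj by blast
    have "kcnj (z - of_real (s / 2)) = kcnj z - of_real (s / 2)"
      using kcnj_add[of "z - of_real (s / 2)" "of_real (s / 2)"] unfolding kcnj_of_real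
      by (simp only: diff_add_cancel) simp
    also have "\<dots> = - (z - of_real (s / 2))"
    proof -
      have "kcnj z = of_real (s / 2 + s / 2) - z"
        using s by (simp only: field_sum_of_halves) (simp add: algebra_simps)
      then show ?thesis by (simp only: of_real_add) simp
    qed
    finally show ?thesis by (metis add_diff_cancel_left' diff_add_cancel add.commute)
  qed
  have sq: "v * v = - of_real ((norm v)\<^sup>2)" if "kcnj v = - v" for v :: 'k
    using mult_kcnj[of v] that by (metis minus_minus mult_minus_right)
  from False obtain z :: 'k where "z \<notin> \<real>" by blast
  moreover obtain r w where w: "z = of_real r + w" "kcnj w = - w" using split by blast
  ultimately have w0: "w \<noteq> 0" by auto
  define \<iota> where "\<iota> = w / of_real (norm w)"
  have ii: "\<iota> * \<iota> = -1"
    using sq[OF w(2)] w0 by (simp add: \<iota>_def power2_eq_square)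
  have iix: "\<iota> * (\<iota> * x) = - x" for x
    using ii by (simp flip: mult.assoc)
  have repr: "\<exists>a b. y = of_real a + of_real b * \<iota>" for y
  proof -
    obtain a v where v: "y = of_real a + v" "kcnj v = - v" using split by blast
    have "v * v = (of_real (norm v) * \<iota>) * (of_real (norm v) * \<iota>)"
      using sq[OF v(2)] by (simp add: power2_eq_square algebra_simps iix)
    then have "v = of_real (norm v) * \<iota> \<or> v = of_real (- norm v) * \<iota>"
      by (simp add: square_eq_iff)
    then show ?thesis using v(1) by metis
  qed
  have ni: "norm \<iota> = 1" using w0 by (simp add: \<iota>_def norm_divide)
  have kc: "kcnj (of_real b * \<iota>) = - (of_real b * \<iota>)" for b
  proof (cases "b = 0")
    case True
    then show ?thesis using kcnj_of_real[of 0, where 'k='k] by simp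
  next
    case False
    have "(of_real b * \<iota>) * kcnj (of_real b * \<iota>) = of_real (b\<^sup>2)"
      unfolding mult_kcnj by (simp add: norm_mult ni)
    also have "\<dots> = (of_real b * \<iota>) * (- (of_real b * \<iota>))"
      by (simp add: power2_eq_square algebra_simps iix)
    finally have "(of_real b * \<iota>) * kcnj (of_real b * \<iota>) = (of_real b * \<iota>) * (- (of_real b * \<iota>))" .
    moreover have "of_real b * \<iota> \<noteq> 0" using False ni by auto
    ultimately show ?thesis using mult_left_cancel by blast
  qed
  have cj: "kcnj (of_real a + of_real b * \<iota>) = of_real a - of_real b * \<iota>" for a b
    by (simp add: kcnj_add kcnj_of_real kc)
  have "norm (of_real a + of_real b * \<iota>) = sqrt (a\<^sup>2 + b\<^sup>2)" for a b
  proof -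
    have "(of_real ((norm (of_real a + of_real b * \<iota>))\<^sup>2) :: 'k)
        = (of_real a + of_real b * \<iota>) * (of_real a - of_real b * \<iota>)"
      using mult_kcnj[of "of_real a + of_real b * \<iota>"] cj by simp
    also have "\<dots> = of_real a * of_real a - of_real b * of_real b * (\<iota> * \<iota>)"
      by (simp add: algebra_simps)
    also have "\<dots> = of_real (a\<^sup>2 + b\<^sup>2)"
      using ii by (simp add: power2_eq_square)
    finally have "(norm (of_real a + of_real b * \<iota>))\<^sup>2 = a\<^sup>2 + b\<^sup>2"
      using of_real_eq_iff by blast
    then show ?thesis by (metis norm_ge_zero real_sqrt_unique)
  qed
  with ii repr cj show ?thesis by blast
qed blast

(* A Hilbert space over K: completeness and the metric come from the type class banach of the
   carrier, sc is the multiplication by K-scalars (extending the real one of the type class), and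
   ip is an inner product, linear in its first argument, that induces the norm. *)
locale hilbert_space = vector_space sc
  for sc :: "'k::real_or_complex \<Rightarrow> 'v::banach \<Rightarrow> 'v" +
  fixes ip :: "'v \<Rightarrow> 'v \<Rightarrow> 'k"
  assumes scale_of_real: "sc (of_real r) x = r *\<^sub>R x"
    and ip_add_left: "ip (x + y) z = ip x z + ip y z"
    and ip_scale_left: "ip (sc c x) y = c * ip x y"
    and ip_commute: "ip x y = kcnj (ip y x)"
    and ip_self: "ip x x = of_real ((norm x)\<^sup>2)"

lemma hilbert_space_real: "hilbert_space scaleR (inner :: 'v::{real_inner,banach} \<Rightarrow> _)"
  by unfold_locales
    (simp_all add: algebra_simps inner_add_left inner_commute power2_norm_eq_inner)

lemma hilbert_space_complex: "hilbert_space (*) (\<lambda>x y :: complex. x * cnj y)"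
  by unfold_locales (simp_all add: algebra_simps complex_norm_square[symmetric] scaleR_conv_of_real del: of_real_power)

definition antilinear :: "('k::real_or_complex \<Rightarrow> 'v::banach \<Rightarrow> 'v) \<Rightarrow> ('v \<Rightarrow> 'k) \<Rightarrow> bool" where
  "antilinear sc L \<longleftrightarrow>
     (\<forall>x y. L (x + y) = L x + L y) \<and> (\<forall>c x. L (sc c x) = kcnj c * L x)"

definition antidual :: "('k::real_or_complex \<Rightarrow> 'v::banach \<Rightarrow> 'v) \<Rightarrow> ('v \<Rightarrow> 'k) set" where
  "antidual sc = {L. antilinear sc L \<and> continuous_on UNIV L}"

definition sesquilinear ::
    "('k::real_or_complex \<Rightarrow> 'v::banach \<Rightarrow> 'v) \<Rightarrow> ('v \<Rightarrow> 'v \<Rightarrow> 'k) \<Rightarrow> bool" where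
  "sesquilinear sc a \<longleftrightarrow>
     (\<forall>v. Vector_Spaces.linear sc (*) (\<lambda>u. a u v)) \<and> (\<forall>u. antilinear sc (a u))"

definition continuous_form :: "('v::banach \<Rightarrow> 'v \<Rightarrow> 'k::real_or_complex) \<Rightarrow> bool" where
  "continuous_form a \<longleftrightarrow> (\<exists>M>0. \<forall>u v. norm (a u v) \<le> M * norm u * norm v)"

definition weakly_converges ::
    "('k::real_or_complex \<Rightarrow> 'v::banach \<Rightarrow> 'v) \<Rightarrow> (nat \<Rightarrow> 'v) \<Rightarrow> 'v \<Rightarrow> bool" where
  "weakly_converges sc u l \<longleftrightarrow>
     (\<forall>f. Vector_Spaces.linear sc (*) f \<and> continuous_on UNIV f \<longrightarrow>
       (\<lambda>n. f (u n)) \<longlonglongrightarrow> f l)"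

definition essentially_coercive ::
    "('k::real_or_complex \<Rightarrow> 'v::banach \<Rightarrow> 'v) \<Rightarrow> ('v \<Rightarrow> 'v \<Rightarrow> 'k) \<Rightarrow> bool" where
  "essentially_coercive sc a \<longleftrightarrow>
     (\<forall>u. weakly_converges sc u 0 \<and> (\<lambda>n. a (u n) (u n)) \<longlonglongrightarrow> 0 \<longrightarrow>
       (\<lambda>n. norm (u n)) \<longlonglongrightarrow> 0)"

definition satisfies_uniqueness :: "('v::banach \<Rightarrow> 'v \<Rightarrow> 'k::real_or_complex) \<Rightarrow> bool" where
  "satisfies_uniqueness a \<longleftrightarrow> (\<forall>u. (\<forall>v. a u v = 0) \<longrightarrow> u = 0)"

definition fin_dim_subspace :: "('k::real_or_complex \<Rightarrow> 'v::banach \<Rightarrow> 'v) \<Rightarrow> 'v set \<Rightarrow> bool" where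
  "fin_dim_subspace sc W \<longleftrightarrow>
     module.subspace sc W \<and> (\<exists>B. finite B \<and> W = module.span sc B)"

(* Approximating sequences are indexed by 1, 2, ...; the value V 0 is irrelevant. *)
definition approximating_sequence ::
    "('k::real_or_complex \<Rightarrow> 'v::banach \<Rightarrow> 'v) \<Rightarrow> (nat \<Rightarrow> 'v set) \<Rightarrow> bool" where
  "approximating_sequence sc V \<longleftrightarrow>
     (\<forall>n\<ge>1. fin_dim_subspace sc (V n)) \<and> (\<forall>v. (\<lambda>n. infdist v (V n)) \<longlonglongrightarrow> 0)"

(* w solves the problem a(w, v) = L(v) for all v with trial and test space W. *)
definition solves_in ::
    "('v::banach \<Rightarrow> 'v \<Rightarrow> 'k::real_or_complex) \<Rightarrow> ('v \<Rightarrow> 'k) \<Rightarrow> 'v set \<Rightarrow> 'v \<Rightarrow> bool" where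
  "solves_in a L W w \<longleftrightarrow> w \<in> W \<and> (\<forall>v\<in>W. a w v = L v)"

definition universal_galerkin ::
    "('k::real_or_complex \<Rightarrow> 'v::banach \<Rightarrow> 'v) \<Rightarrow> ('v \<Rightarrow> 'v \<Rightarrow> 'k) \<Rightarrow> bool" where
  "universal_galerkin sc a \<longleftrightarrow>
     (\<forall>L\<in>antidual sc. \<exists>!u. solves_in a L UNIV u) \<and>
     (\<forall>V. approximating_sequence sc V \<longrightarrow>
       (\<exists>n\<^sub>0\<ge>1. \<exists>\<gamma>>0. \<forall>L\<in>antidual sc. \<forall>n\<ge>n\<^sub>0.
          (\<exists>!w. solves_in a L (V n) w) \<and>
          (\<forall>u w. solves_in a L UNIV u \<and> solves_in a L (V n) w \<longrightarrow>
             norm (u - w) \<le> \<gamma> * infdist u (V n))))"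

end

theory Submission
  imports Defs "HOL-Library.Diagonal_Subsequence"
begin

text \<open>
  Both implications compare the form \<open>a\<close> with its restrictions to the subspaces \<open>V n\<close> of an
  approximating sequence; the link is the discrete inf-sup condition with a constant that does
  not depend on \<open>n\<close>: for some \<open>\<beta> > 0\<close>, all large \<open>n\<close> and every \<open>u\<close> in \<open>V n\<close>, the functional
  \<open>v \<mapsto> a u v\<close> on \<open>V n\<close> has norm at least \<open>\<beta> * norm u\<close>.

  Assume essential coercivity and uniqueness. If the uniform inf-sup condition failed, there would
  be unit vectors \<open>e k\<close> in spaces \<open>V (N k)\<close> with \<open>N k \<rightarrow> \<infinity>\<close> on which the functionals \<open>a (e k)\<close> have norm at
  most \<open>1/(k+1)\<close>. A subsequence converges weakly to some \<open>l\<close>. Since every \<open>v\<close> is a limit of elements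
  of the \<open>V (N k)\<close>, \<open>a l v = 0\<close> for all \<open>v\<close>, so \<open>l = 0\<close> by uniqueness. But also
  \<open>a (e k) (e k) \<rightarrow> 0\<close>, and essential coercivity makes the unit vectors converge to \<open>0\<close>, which is
  absurd (\<open>uniform_inf_sup\<close>). The inf-sup condition makes the finite-dimensional problems uniquely
  solvable (\<open>inf_sup_unique_solution\<close>) and their solutions quasi-optimal, by Cea's argument
  (\<open>inf_sup_quasi_optimal\<close>). The solution of the full problem is a weak limit of these discrete
  solutions, which are bounded (\<open>full_solution_exists\<close>).

  Conversely, uniqueness is the case \<open>L = 0\<close> of unique solvability. If \<open>a\<close> is not essentially coercive,
  a weakly null sequence \<open>u k\<close> of vectors with norms bounded away from \<open>0\<close> satisfies
  \<open>a (u k) (u k) \<rightarrow> 0\<close>. Given finitely many basis vectors, a late normalised member \<open>e\<close> of it is almost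
  orthogonal to them, and \<open>a v e\<close> is small for all \<open>v\<close> in the span of the basis vectors and \<open>e\<close>
  itself (\<open>almost_degenerate_direction\<close>). Adding such a vector \<open>e n\<close> to the span of the first
  \<open>n\<close> basis vectors gives an approximating sequence \<open>V\<close> for which \<open>a v (e n)\<close> is at most
  \<open>(1/4)^n * norm v\<close> on \<open>V n\<close>. The Galerkin solutions for a functional \<open>L\<close> are bounded
  by quasi-optimality, so \<open>L (e n) = a w (e n) = O((1/4)^n)\<close> for every \<open>L\<close>. This contradicts the
  existence of a functional with \<open>norm (L (e n)) \<ge> (1/3)^n / 2\<close> for all \<open>n\<close> (\<open>gliding_hump\<close>). The
  small vector is placed in the second argument of \<open>a\<close> so that no bound for the solution operator
  of the full problem enters.

  Weak compactness of bounded sequences comes from an orthogonal sequence with dense span: it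
  reduces the claim to coordinates, where a diagonal argument applies.
\<close>

section \<open>The scalar field\<close>

lemma kcnj_zero [simp]: "kcnj (0 :: 'k::real_or_complex) = 0"
  using kcnj_add[of "0::'k" 0] by simp

text \<open>The properties of conjugation all follow from \<open>x * kcnj x = (norm x)^2\<close> by cancelling a nonzero factor.\<close>

lemma norm_kcnj [simp]: "norm (kcnj x) = norm (x :: 'k::real_or_complex)"
proof (cases "x = 0")
  case False
  have "norm x * norm (kcnj x) = norm x * norm x"
    using arg_cong[OF mult_kcnj[of x], of norm] by (simp add: norm_mult power2_eq_square)
  then show ?thesis using False by simp
qed simp

lemma kcnj_kcnj [simp]: "kcnj (kcnj x) = (x :: 'k::real_or_complex)"
proof (cases "x = 0")
  case False
  then have "kcnj x \<noteq> 0" by (metis norm_kcnj norm_eq_zero)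
  moreover have "kcnj x * kcnj (kcnj x) = kcnj x * x"
    using mult_kcnj[of x] mult_kcnj[of "kcnj x"] by (simp add: mult.commute)
  ultimately show ?thesis by simp
qed simp

lemma kcnj_mult: "kcnj (x * y) = kcnj x * kcnj (y :: 'k::real_or_complex)"
proof (cases "x * y = 0")
  case False
  have "(x * y) * kcnj (x * y) = of_real ((norm x)\<^sup>2) * of_real ((norm y)\<^sup>2)"
    unfolding mult_kcnj by (simp add: norm_mult power_mult_distrib)
  also have "\<dots> = (x * y) * (kcnj x * kcnj y)"
    unfolding mult_kcnj[symmetric] by (simp add: ac_simps)
  finally show ?thesis using False by (metis mult_left_cancel)
qed auto

text \<open>Every scalar has the form \<open>x + y * \<iota>\<close> with real \<open>x\<close>, \<open>y\<close> controlled by its norm, so compactness of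
  bounded sets can be transferred from pairs of real numbers. For real scalars
  \<open>\<iota> = 0\<close> serves.\<close>

lemma scalar_bounded_subsequence:
  fixes z :: "nat \<Rightarrow> 'k::real_or_complex"
  assumes bound: "\<And>n. norm (z n) \<le> R"
  shows "\<exists>l r. strict_mono r \<and> (z \<circ> r) \<longlonglongrightarrow> l"
proof -
  have "\<exists>\<iota> :: 'k. \<forall>w. \<exists>x y. w = of_real x + of_real y * \<iota> \<and> x\<^sup>2 + y\<^sup>2 \<le> (norm w)\<^sup>2"
    using scalar_field_cases[where 'k='k]
  proof (elim disjE exE conjE)
    assume real: "\<forall>z :: 'k. z \<in> \<real>"
    have "\<exists>x y. w = of_real x + of_real y * 0 \<and> x\<^sup>2 + y\<^sup>2 \<le> (norm w)\<^sup>2" for w :: 'k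
    proof -
      obtain x where "w = of_real x" using real by (blast elim: Reals_cases)
      then show ?thesis by (intro exI[of _ x] exI[of _ 0]) simp
    qed
    then show ?thesis by blast
  next
    fix \<iota> :: 'k
    assume a: "\<forall>z. \<exists>a b. z = of_real a + of_real b * \<iota>"
      "\<forall>a b. norm (of_real a + of_real b * \<iota>) = sqrt (a\<^sup>2 + b\<^sup>2) \<and>
       kcnj (of_real a + of_real b * \<iota>) = of_real a - of_real b * \<iota>"
    have "\<exists>x y. w = of_real x + of_real y * \<iota> \<and> x\<^sup>2 + y\<^sup>2 \<le> (norm w)\<^sup>2" for w
    proof -
      obtain x y where w: "w = of_real x + of_real y * \<iota>" using a(1) by blast
      then have "x\<^sup>2 + y\<^sup>2 \<le> (norm w)\<^sup>2" using a(2) by simp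
      with w show ?thesis by blast
    qed
    then show ?thesis by blast
  qed
  then obtain \<iota> :: 'k
    where "\<forall>w. \<exists>x y. w = of_real x + of_real y * \<iota> \<and> x\<^sup>2 + y\<^sup>2 \<le> (norm w)\<^sup>2" by blast
  then have "\<forall>n. \<exists>p. z n = of_real (fst p) + of_real (snd p) * \<iota> \<and>
      (fst p)\<^sup>2 + (snd p)\<^sup>2 \<le> (norm (z n))\<^sup>2" by simp
  then obtain p where p: "\<And>n. z n = of_real (fst (p n)) + of_real (snd (p n)) * \<iota>"
      "\<And>n. (fst (p n))\<^sup>2 + (snd (p n))\<^sup>2 \<le> (norm (z n))\<^sup>2"
    using choice by meson
  have "norm (p n) \<le> R" for n
  proof -
    have "norm (p n) \<le> norm (z n)"
      using p(2)[of n] by (simp add: norm_prod_def real_le_lsqrt)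
    then show ?thesis using bound[of n] by linarith
  qed
  then have "bounded (range p)"
    unfolding bounded_iff by blast
  then obtain l r where r: "strict_mono r" "(p \<circ> r) \<longlonglongrightarrow> l"
    using bounded_imp_convergent_subsequence by blast
  have "(\<lambda>n. of_real (fst ((p \<circ> r) n)) + of_real (snd ((p \<circ> r) n)) * \<iota>)
      \<longlonglongrightarrow> of_real (fst l) + of_real (snd l) * \<iota>"
    by (intro tendsto_intros r(2))
  then have "(z \<circ> r) \<longlonglongrightarrow> of_real (fst l) + of_real (snd l) * \<iota>"
    by (simp add: o_def p(1)[symmetric])
  with r(1) show ?thesis by blast
qed

section \<open>Hilbert spaces over the scalar field\<close>

text \<open>Homogeneity is required for real factors only, so that linear functionals as well as antilinear
  ones are covered, whatever the scalar field.\<close>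

lemma continuous_additive_bounded_linear:
  fixes f :: "'a::real_normed_vector \<Rightarrow> 'b::real_normed_vector"
  assumes add: "\<And>x y. f (x + y) = f x + f y" and scale: "\<And>r x. f (r *\<^sub>R x) = r *\<^sub>R f x"
    and cont: "continuous_on UNIV f"
  shows "bounded_linear f"
proof -
  have f0: "f 0 = 0" using scale[of 0 0] by simp
  have "continuous (at 0) f" using cont by (simp add: continuous_on_eq_continuous_at)
  then obtain d where d: "d > 0" "\<And>x. norm x < d \<Longrightarrow> norm (f x) < 1"
    unfolding continuous_at_eps_delta using f0 by (metis diff_zero dist_norm zero_less_one)
  show ?thesis
  proof (rule bounded_linear_intro[OF add scale])
    fix x :: 'a
    show "norm (f x) \<le> norm x * (2 / d)"
    proof (cases "x = 0")
      case False
      have "norm (f ((d / (2 * norm x)) *\<^sub>R x)) < 1"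
        using d(1) False by (intro d(2)) simp
      then have "(d / (2 * norm x)) * norm (f x) < 1"
        using d(1) by (simp add: scale)
      then show ?thesis using d(1) False by (simp add: field_simps)
    qed (simp add: f0)
  qed
qed

context hilbert_space
begin

lemma linear_functional_iff:
  "Vector_Spaces.linear sc (*) f \<longleftrightarrow> (\<forall>x y. f (x + y) = f x + f y) \<and> (\<forall>c x. f (sc c x) = c * f x)"
proof -
  have "vector_space ((*) :: 'k \<Rightarrow> 'k \<Rightarrow> 'k)" by unfold_locales (auto simp: algebra_simps)
  then show ?thesis using vector_space_axioms by (simp add: Vector_Spaces.linear_iff)
qed

lemma continuous_functional_bounded_linear:
  assumes "Vector_Spaces.linear sc (*) f" "continuous_on UNIV f"
  shows "bounded_linear f"
  using assms unfolding linear_functional_iff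
  by (intro continuous_additive_bounded_linear) (auto simp flip: scale_of_real simp: scaleR_conv_of_real)

lemma antidual_bounded_linear:
  assumes "L \<in> antidual sc"
  shows "bounded_linear L"
  using assms unfolding antidual_def antilinear_def
  by (intro continuous_additive_bounded_linear)
     (auto simp flip: scale_of_real simp: kcnj_of_real scaleR_conv_of_real)

lemma ip_scaleR_left: "ip (r *\<^sub>R x) y = r *\<^sub>R ip x y"
  by (simp flip: scale_of_real add: ip_scale_left scaleR_conv_of_real)

lemma ip_add_right: "ip x (y + z) = ip x y + ip x z"
  by (metis ip_commute ip_add_left kcnj_add)

lemma ip_scale_right: "ip x (sc c y) = kcnj c * ip x y"
  by (metis ip_commute ip_scale_left kcnj_mult)

lemma ip_scaleR_right: "ip x (r *\<^sub>R y) = r *\<^sub>R ip x y"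
  by (simp flip: scale_of_real add: ip_scale_right kcnj_of_real scaleR_conv_of_real)

lemma norm_ip_commute: "norm (ip x y) = norm (ip y x)"
  by (metis ip_commute norm_kcnj)

lemma ip_zero_left [simp]: "ip 0 y = 0"
  using ip_scaleR_left[of 0 0 y] by simp

lemma ip_zero_right [simp]: "ip x 0 = 0"
  using ip_scaleR_right[of x 0 0] by simp

lemma norm_scale: "norm (sc c x) = norm c * norm x"
proof -
  have "(of_real ((norm (sc c x))\<^sup>2) :: 'k) = c * kcnj c * of_real ((norm x)\<^sup>2)"
    unfolding ip_self[symmetric] by (simp add: ip_scale_left ip_scale_right)
  also have "\<dots> = of_real ((norm c * norm x)\<^sup>2)"
    by (simp add: mult_kcnj power_mult_distrib)
  finally have "(norm (sc c x))\<^sup>2 = (norm c * norm x)\<^sup>2" using of_real_eq_iff by blast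
  then show ?thesis by (simp add: power2_eq_iff_nonneg)
qed

lemma pythagoras:
  assumes "ip x y = 0"
  shows "(norm (x + y))\<^sup>2 = (norm x)\<^sup>2 + (norm y)\<^sup>2"
proof -
  have "ip y x = 0" using assms by (metis ip_commute kcnj_zero)
  then have "(of_real ((norm (x + y))\<^sup>2) :: 'k) = of_real ((norm x)\<^sup>2 + (norm y)\<^sup>2)"
    using assms by (simp flip: ip_self add: ip_add_left ip_add_right del: of_real_power)
  then show ?thesis using of_real_eq_iff by blast
qed

lemma cauchy_schwarz: "norm (ip x y) \<le> norm x * norm y"
proof (cases "y = 0")
  case False
  \<comment> \<open>The orthogonal projection of \<open>x\<close> to the line spanned by \<open>y\<close>.\<close>
  define p where "p = sc (ip x y / of_real ((norm y)\<^sup>2)) y"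
  have py: "ip p y = ip x y" using False by (simp add: p_def ip_scale_left ip_self)
  have "ip (x - p) y = 0"
    using ip_add_left[of "x - p" p y] py by simp
  then have "ip (x - p) p = 0" by (simp add: p_def ip_scale_right)
  then have "(norm p)\<^sup>2 \<le> (norm x)\<^sup>2"
    using pythagoras[of "x - p" p] by simp
  then have "norm p \<le> norm x" by (rule power2_le_imp_le) simp
  moreover have "norm p * norm y = norm (ip x y)"
    using False by (simp add: p_def norm_scale norm_divide norm_mult power2_eq_square)
  ultimately show ?thesis by (metis mult_right_mono norm_ge_zero)
qed simp

lemma bounded_linear_ip_left: "bounded_linear (\<lambda>x. ip x y)"
  by (rule bounded_linear_intro[OF ip_add_left ip_scaleR_left cauchy_schwarz])

lemma bounded_linear_ip_right: "bounded_linear (ip x)"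
proof (rule bounded_linear_intro)
  show "norm (ip x y) \<le> norm y * norm x" for y
    using cauchy_schwarz[of x y] by (simp add: mult.commute)
qed (simp_all add: ip_add_right ip_scaleR_right)

lemma ip_sum_left: "ip (\<Sum>i\<in>A. f i) y = (\<Sum>i\<in>A. ip (f i) y)"
  by (rule linear_sum[OF bounded_linear.linear[OF bounded_linear_ip_left]])

lemma ip_diff_left: "ip (x - y) z = ip x z - ip y z"
  by (rule linear_diff[OF bounded_linear.linear[OF bounded_linear_ip_left]])

lemma ip_diff_right: "ip z (x - y) = ip z x - ip z y"
  by (rule linear_diff[OF bounded_linear.linear[OF bounded_linear_ip_right]])

lemma ip_weakly_continuous:
  assumes "weakly_converges sc u l"
  shows "(\<lambda>n. ip (u n) y) \<longlonglongrightarrow> ip l y"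
proof -
  have "Vector_Spaces.linear sc (*) (\<lambda>x. ip x y)"
    by (simp add: linear_functional_iff ip_add_left ip_scale_left)
  moreover have "continuous_on UNIV (\<lambda>x. ip x y)"
    by (rule bounded_linear.continuous_on[OF bounded_linear_ip_left continuous_on_id])
  ultimately show ?thesis using assms unfolding weakly_converges_def by blast
qed

lemma ip_right_in_antidual: "ip y \<in> antidual sc"
  using bounded_linear.continuous_on[OF bounded_linear_ip_right continuous_on_id, of UNIV y]
  by (simp add: antidual_def antilinear_def ip_add_right ip_scale_right)

text \<open>A Hilbert space form of the uniform boundedness principle. Adding or subtracting \<open>(1/3)^n * e n\<close> changes
  the product with \<open>e n\<close> so much that one of the two signs makes it at least \<open>(1/3)^n\<close>; the later
  corrections have total length at most \<open>(1/3)^n / 2\<close> and destroy at most half of this.\<close>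

lemma gliding_hump:
  assumes unit: "\<And>n. norm (e n) = 1"
  shows "\<exists>y. \<forall>n. (1/3) ^ n / 2 \<le> norm (ip (e n) y)"
proof -
  have "\<exists>Y. \<forall>n. True \<and> (norm (Y (Suc n) - Y n) \<le> (1/3)^n \<and> (1/3)^n \<le> norm (ip (e n) (Y (Suc n))))"
  proof (rule dependent_nat_choice[where P = "\<lambda>_ _. True"
      and Q = "\<lambda>n x x'. norm (x' - x) \<le> (1/3)^n \<and> (1/3)^n \<le> norm (ip (e n) x')"])
    fix x :: 'v and n
    define h where "h = ((1/3)^n) *\<^sub>R e n"
    have nh: "norm h = (1/3)^n" by (simp add: h_def unit)
    have "ip (e n) h = of_real ((1/3)^n)"
      by (simp add: h_def ip_scaleR_right ip_self unit scaleR_conv_of_real del: of_real_power)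
    then have "norm (ip (e n) (x + h) - ip (e n) (x - h)) = 2 * (1/3)^n"
      by (simp add: ip_add_right ip_diff_right norm_mult norm_divide norm_power flip: mult_2)
    then have "2 * (1/3)^n \<le> norm (ip (e n) (x + h)) + norm (ip (e n) (x - h))"
      by (metis norm_triangle_ineq4)
    then consider "(1/3)^n \<le> norm (ip (e n) (x + h))" | "(1/3)^n \<le> norm (ip (e n) (x - h))"
      by linarith
    then show "\<exists>x'. True \<and> norm (x' - x) \<le> (1/3)^n \<and> (1/3)^n \<le> norm (ip (e n) x')"
    proof cases
      case 1 then show ?thesis using nh by (intro exI[of _ "x + h"]) simp
    next
      case 2 then show ?thesis using nh by (intro exI[of _ "x - h"]) simp
    qed
  qed simp
  then obtain Y where step: "\<And>n. norm (Y (Suc n) - Y n) \<le> (1/3)^n"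
    and large: "\<And>n. (1/3)^n \<le> norm (ip (e n) (Y (Suc n)))" by auto
  \<comment> \<open>The steps up to \<open>m\<close> add up to a geometric sum; the exact form of the bound lets induction go through.\<close>
  have tail': "norm (Y m - Y n) \<le> (3/2) * ((1/3)^n - (1/3)^m)" if "n \<le> m" for m n
    using that
  proof (induction rule: dec_induct)
    case (step m)
    have "norm (Y (Suc m) - Y n) \<le> norm (Y (Suc m) - Y m) + norm (Y m - Y n)"
      using norm_triangle_ineq[of "Y (Suc m) - Y m" "Y m - Y n"] by simp
    with step.IH \<open>\<And>n. norm (Y (Suc n) - Y n) \<le> (1/3)^n\<close>[of m] show ?case by simp
  qed simp
  have tail: "norm (Y m - Y n) \<le> (3/2) * (1/3)^n" if "n \<le> m" for m n
    by (rule order_trans[OF tail'[OF that]]) simp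
  have null: "(\<lambda>n. (3/2) * (1/3)^n) \<longlonglongrightarrow> (0::real)"
    by (rule tendsto_mult_right_zero, rule LIMSEQ_realpow_zero) auto
  have "Cauchy Y"
  proof (rule CauchyI')
    fix \<epsilon> :: real assume "\<epsilon> > 0"
    then obtain M where M: "\<And>n. n \<ge> M \<Longrightarrow> (3/2) * (1/3)^n < \<epsilon>"
      using order_tendstoD(2)[OF null] by (auto simp: eventually_sequentially)
    have "dist (Y m) (Y n) < \<epsilon>" if "m \<ge> M" "n > m" for m n
      using tail[of m n] M[of m] that by (simp add: dist_norm norm_minus_commute)
    then show "\<exists>M. \<forall>m\<ge>M. \<forall>n>m. dist (Y m) (Y n) < \<epsilon>" by blast
  qed
  then obtain y where y: "Y \<longlonglongrightarrow> y" using Cauchy_convergent_iff convergent_def by blast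
  have "(1/3)^n / 2 \<le> norm (ip (e n) y)" for n
  proof -
    have "norm (y - Y (Suc n)) \<le> (3/2) * (1/3)^(Suc n)"
      by (rule LIMSEQ_le_const2[OF tendsto_norm[OF tendsto_diff[OF y tendsto_const]]])
        (use tail in blast)
    then have "norm (ip (e n) (y - Y (Suc n))) \<le> (1/3)^n / 2"
      using cauchy_schwarz[of "e n" "y - Y (Suc n)"] unit by simp
    moreover have "ip (e n) (Y (Suc n)) = ip (e n) y - ip (e n) (y - Y (Suc n))"
      by (simp add: ip_diff_right)
    ultimately show ?thesis
      using large[of n] norm_triangle_ineq4[of "ip (e n) y" "ip (e n) (y - Y (Suc n))"] by simp
  qed
  then show ?thesis by blast
qed

text \<open>
  The congruence rule tells the termination prover that the recursive calls inside the sum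
  have smaller indices. A vector that depends linearly on its predecessors yields \<open>0\<close>, because the reciprocal of \<open>0\<close> is \<open>0\<close>.
\<close>

declare sum.cong [fundef_cong]

fun gram_schmidt :: "(nat \<Rightarrow> 'v) \<Rightarrow> nat \<Rightarrow> 'v" where
  "gram_schmidt d n =
     (let r = d n - (\<Sum>i\<in>{..<n}. sc (ip (d n) (gram_schmidt d i)) (gram_schmidt d i)) in r /\<^sub>R norm r)"

declare gram_schmidt.simps [simp del]

lemma norm_gram_schmidt: "gram_schmidt d n = 0 \<or> norm (gram_schmidt d n) = 1"
proof -
  have "r /\<^sub>R norm r = 0 \<or> norm (r /\<^sub>R norm r) = 1" for r :: 'v by (cases "r = 0") simp_all
  then show ?thesis unfolding gram_schmidt.simps[of d n] Let_def by blast
qed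

lemma gram_schmidt_orthogonal: "i < n \<Longrightarrow> ip (gram_schmidt d n) (gram_schmidt d i) = 0"
proof (induction n arbitrary: i rule: less_induct)
  case (less n)
  let ?b = "gram_schmidt d"
  have o: "ip (?b j) (?b i) = 0" if "j < n" "j \<noteq> i" for j
    using that less.IH[of j i] less.IH[of i j] less.prems
    by (metis ip_commute kcnj_zero linorder_neqE_nat)
  have "ip (\<Sum>j\<in>{..<n}. sc (ip (d n) (?b j)) (?b j)) (?b i)
      = (\<Sum>j\<in>{..<n}. if j = i then ip (d n) (?b i) * ip (?b i) (?b i) else 0)"
    unfolding ip_sum_left by (intro sum.cong) (auto simp: ip_scale_left o)
  also have "\<dots> = ip (d n) (?b i)"
    using less.prems norm_gram_schmidt[of d i] by (auto simp: ip_self)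
  finally show ?case
    unfolding gram_schmidt.simps[of d n] by (simp add: Let_def ip_scaleR_left ip_diff_left)
qed

lemma gram_schmidt_span: "d n \<in> span (gram_schmidt d ` {..n})"
proof -
  let ?b = "gram_schmidt d"
  define r where "r = d n - (\<Sum>i\<in>{..<n}. sc (ip (d n) (?b i)) (?b i))"
  have "?b n = r /\<^sub>R norm r" unfolding gram_schmidt.simps[of d n] by (simp add: Let_def r_def)
  then have "r = sc (of_real (norm r)) (?b n)" by (cases "r = 0") (simp_all add: scale_of_real)
  then have "r \<in> span (?b ` {..n})" by (metis span_scale span_base imageI atMost_iff order_refl)
  moreover have "(\<Sum>i\<in>{..<n}. sc (ip (d n) (?b i)) (?b i)) \<in> span (?b ` {..n})"
    by (intro span_sum span_scale span_base) auto
  ultimately have "r + (\<Sum>i\<in>{..<n}. sc (ip (d n) (?b i)) (?b i)) \<in> span (?b ` {..n})"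
    by (rule span_add)
  then show ?thesis by (simp add: r_def)
qed

end

section \<open>Separable Hilbert spaces and weak compactness\<close>

text \<open>The sequence \<open>b\<close> is an orthonormal basis possibly padded with zero vectors. Gram-Schmidt applied to a
  dense sequence gives exactly this, and a zero vector contributes nothing to any expansion.\<close>

locale separable_hilbert_space = hilbert_space sc ip
  for sc :: "'k::real_or_complex \<Rightarrow> 'v::banach \<Rightarrow> 'v" and ip :: "'v \<Rightarrow> 'v \<Rightarrow> 'k" +
  fixes b :: "nat \<Rightarrow> 'v"
  assumes orthogonal: "i \<noteq> j \<Longrightarrow> ip (b i) (b j) = 0"
    and unit_or_zero: "b i = 0 \<or> norm (b i) = 1"
    and total: "(\<lambda>n. infdist v (span (b ` {..<n}))) \<longlonglongrightarrow> 0"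

lemma (in hilbert_space) separable_imp_total_orthogonal_sequence:
  assumes "separable_space (euclidean :: 'v topology)"
  shows "\<exists>b. separable_hilbert_space sc ip b"
proof -
  obtain C :: "'v set" where C: "countable C" "closure C = UNIV"
    using assms by (auto simp: separable_space_def)
  then have "C \<noteq> {}" by (metis closure_empty UNIV_not_empty)
  define d where "d = from_nat_into C"
  have range_d: "range d = C" using C \<open>C \<noteq> {}\<close> by (simp add: d_def range_from_nat_into)
  let ?b = "gram_schmidt d"
  have "separable_hilbert_space sc ip ?b"
  proof unfold_locales
    show "ip (?b i) (?b j) = 0" if "i \<noteq> j" for i j
      using that gram_schmidt_orthogonal[of i j d] gram_schmidt_orthogonal[of j i d]
        ip_commute[of "?b i" "?b j"] by (cases i j rule: linorder_cases) auto
    show "?b i = 0 \<or> norm (?b i) = 1" for i by (rule norm_gram_schmidt)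
    show "(\<lambda>n. infdist v (span (?b ` {..<n}))) \<longlonglongrightarrow> 0" for v
    proof (rule order_tendstoI)
      fix \<epsilon> :: real assume "\<epsilon> > 0"
      moreover have "v \<in> closure (range d)" using C(2) range_d by simp
      ultimately obtain m where m: "dist (d m) v < \<epsilon>"
        unfolding closure_approachable by blast
      have "infdist v (span (?b ` {..<n})) < \<epsilon>" if "n > m" for n
      proof -
        have "span (?b ` {..m}) \<subseteq> span (?b ` {..<n})"
          using that by (intro span_mono image_mono) auto
        then have "infdist v (span (?b ` {..<n})) \<le> dist v (d m)"
          using gram_schmidt_span[of d m] by (intro infdist_le) blast
        with m show ?thesis by (simp add: dist_commute)
      qed
      then show "\<forall>\<^sub>F n in sequentially. infdist v (span (?b ` {..<n})) < \<epsilon>"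
        using eventually_gt_at_top[of m] by (rule eventually_mono[rotated])
    qed (auto intro: always_eventually less_le_trans infdist_nonneg)
  qed
  then show ?thesis by blast
qed

lemma linear_le_infdistI:
  fixes A :: "'a::metric_space set"
  assumes "A \<noteq> {}" "K > 0" "\<And>x. x \<in> A \<Longrightarrow> c \<le> K * dist v x"
  shows "c \<le> K * infdist v A"
proof -
  have "c / K \<le> infdist v A"
    unfolding infdist_notempty[OF assms(1)] using assms
    by (intro cINF_greatest) (auto simp: field_simps)
  then show ?thesis using assms(2) by (simp add: field_simps)
qed

context separable_hilbert_space
begin

text \<open>The density argument used throughout: a property that defines a closed subspace need be checked on
  the basis vectors only.\<close>

lemma closed_subspace_eq_UNIV:
  assumes "subspace S" "closed S" "range b \<subseteq> S"
  shows "S = UNIV"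
proof -
  have "v \<in> S" for v
  proof -
    have ne: "S \<noteq> {}" using assms(3) by auto
    have "span (b ` {..<n}) \<subseteq> S" for n
      using assms(1,3) by (intro span_minimal) auto
    then have "infdist v S \<le> infdist v (span (b ` {..<n}))" for n
      by (rule infdist_mono) (use span_zero in blast)
    then have "infdist v S \<le> 0"
      by (intro LIMSEQ_le_const[OF total]) auto
    then have "infdist v S = 0" using infdist_nonneg[of v S] by linarith
    with assms(2) ne show ?thesis by (simp add: in_closed_iff_infdist_zero)
  qed
  then show ?thesis by blast
qed

lemma span_expansion:
  assumes "w \<in> span (b ` {..<n})"
  shows "w = (\<Sum>i<n. sc (ip w (b i)) (b i))"
  using assms
proof (induction rule: span_induct_alt)
  case (step c x y)
  then obtain j where j: "j < n" "x = b j" by auto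
  have "(\<Sum>i<n. sc (ip (sc c x + y) (b i)) (b i)) = (\<Sum>i<n. sc (c * ip x (b i)) (b i)) + y"
    using step.IH by (simp add: ip_add_left ip_scale_left scale_left_distrib sum.distrib)
  also have "(\<Sum>i<n. sc (c * ip x (b i)) (b i)) = (\<Sum>i<n. if i = j then sc c x else 0)"
    using orthogonal[of j] unit_or_zero[of j] by (intro sum.cong) (auto simp: j ip_self)
  finally show ?case using j by simp
qed simp

text \<open>Only an inequality, since the terms with \<open>b i = 0\<close> vanish on the left.\<close>

lemma norm_combination_le:
  assumes "finite A"
  shows "(norm (\<Sum>i\<in>A. sc (c i) (b i)))\<^sup>2 \<le> (\<Sum>i\<in>A. (norm (c i))\<^sup>2)"
  using assms
proof (induction A)
  case (insert j A)
  have "ip (\<Sum>i\<in>A. sc (c i) (b i)) (sc (c j) (b j)) = 0"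
    unfolding ip_sum_left using insert.hyps(2)
    by (intro sum.neutral) (auto simp: ip_scale_left ip_scale_right intro!: orthogonal)
  from pythagoras[OF this]
  have "(norm (\<Sum>i\<in>insert j A. sc (c i) (b i)))\<^sup>2
      = (norm (\<Sum>i\<in>A. sc (c i) (b i)))\<^sup>2 + (norm (sc (c j) (b j)))\<^sup>2"
    using insert.hyps by (simp add: add.commute)
  moreover have "(norm (sc (c j) (b j)))\<^sup>2 \<le> (norm (c j))\<^sup>2"
    using unit_or_zero[of j] by (auto simp: norm_scale)
  moreover have "(\<Sum>i\<in>insert j A. (norm (c i))\<^sup>2) = (norm (c j))\<^sup>2 + (\<Sum>i\<in>A. (norm (c i))\<^sup>2)"
    using insert.hyps by simp
  ultimately show ?case using insert.IH by linarith
qed simp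

text \<open>Evaluate \<open>f\<close> at \<open>y = (\<Sum>i<n. kcnj (f (b i)) * b i)\<close>: the value is the sum \<open>s\<close> to be bounded, and \<open>y\<close> has norm at
  most \<open>sqrt s\<close>, so \<open>s \<le> C * sqrt s\<close>. The usual Bessel inequality for a vector \<open>u\<close> is the case \<open>f x = ip x u\<close>.\<close>

lemma bessel:
  assumes add: "\<And>x y. f (x + y) = f x + f y" and scale: "\<And>c x. f (sc c x) = c * f x"
    and bound: "\<And>x. norm (f x) \<le> C * norm x"
  shows "(\<Sum>i<n. (norm (f (b i)))\<^sup>2) \<le> C\<^sup>2"
proof -
  define s where "s = (\<Sum>i<n. (norm (f (b i)))\<^sup>2)"
  define y where "y = (\<Sum>i<n. sc (kcnj (f (b i))) (b i))"
  have s0: "s \<ge> 0" unfolding s_def by (intro sum_nonneg) simp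
  have f0: "f 0 = 0" using add[of 0 0] by simp
  have "f (\<Sum>i\<in>A. g i) = (\<Sum>i\<in>A. f (g i))" for A and g :: "nat \<Rightarrow> 'v"
    by (induction A rule: infinite_finite_induct) (auto simp: add f0)
  then have "f y = (\<Sum>i<n. f (b i) * kcnj (f (b i)))"
    by (simp add: y_def scale mult.commute)
  then have "f y = of_real s" by (simp add: mult_kcnj s_def)
  then have "s \<le> C * norm y" using bound[of y] s0 by simp
  moreover have "(norm y)\<^sup>2 \<le> s"
    unfolding y_def s_def by (rule order_trans[OF norm_combination_le]) simp_all
  ultimately have "s\<^sup>2 \<le> C\<^sup>2 * s"
    using power_mono[OF \<open>s \<le> C * norm y\<close> s0, of 2] 
    by (smt (verit) mult_left_mono power_mult_distrib zero_le_power2)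
  then show ?thesis
    using s0 unfolding s_def[symmetric] by (cases "s = 0") (auto simp: power2_eq_square)
qed

text \<open>The series with coefficients \<open>c i\<close> is Cauchy, as the norms of its blocks are bounded by blocks of a
  convergent real series. A coefficient at a zero vector must vanish, since it cannot be recovered.\<close>

lemma riesz_fischer:
  assumes bound: "\<And>n. (\<Sum>i<n. (norm (c i))\<^sup>2) \<le> R" and zero: "\<And>i. b i = 0 \<Longrightarrow> c i = 0"
  shows "\<exists>y. \<forall>i. ip y (b i) = c i"
proof -
  define S where "S n = (\<Sum>i<n. sc (c i) (b i))" for n
  have "summable (\<lambda>i. (norm (c i))\<^sup>2)"
  proof (rule bounded_imp_summable)
    show "(\<Sum>i\<le>n. (norm (c i))\<^sup>2) \<le> R" for n
      using bound[of "Suc n"] by (simp add: lessThan_Suc_atMost)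
  qed simp
  then have tails: "\<exists>N. \<forall>m\<ge>N. \<forall>n. norm (\<Sum>i\<in>{m..<n}. (norm (c i))\<^sup>2) < \<epsilon>" if "\<epsilon> > 0" for \<epsilon>
    using that by (simp add: summable_Cauchy)
  have "Cauchy S"
  proof (rule CauchyI')
    fix \<epsilon> :: real assume "\<epsilon> > 0"
    then obtain N where N: "\<And>m n. m \<ge> N \<Longrightarrow> norm (\<Sum>i\<in>{m..<n}. (norm (c i))\<^sup>2) < \<epsilon>\<^sup>2"
      using tails[of "\<epsilon>\<^sup>2"] by auto
    have "dist (S m) (S n) < \<epsilon>" if "m \<ge> N" "n > m" for m n
    proof -
      have "S n - S m = (\<Sum>i\<in>{m..<n}. sc (c i) (b i))"
        using that(2) by (simp add: S_def sum_diff_nat_ivl lessThan_atLeast0)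
      then have "(norm (S n - S m))\<^sup>2 < \<epsilon>\<^sup>2"
        using norm_combination_le[of "{m..<n}" c] N[OF that(1), of n] by simp
      then have "norm (S n - S m) < \<epsilon>"
        using \<open>\<epsilon> > 0\<close> by (simp add: power2_less_imp_less)
      then show ?thesis by (simp add: dist_norm norm_minus_commute)
    qed
    then show "\<exists>M. \<forall>m\<ge>M. \<forall>n>m. dist (S m) (S n) < \<epsilon>" by blast
  qed
  then obtain y where y: "S \<longlonglongrightarrow> y" using Cauchy_convergent_iff convergent_def by blast
  have "ip y (b j) = c j" for j
  proof (rule LIMSEQ_unique)
    show "(\<lambda>n. ip (S n) (b j)) \<longlonglongrightarrow> ip y (b j)"
      by (rule bounded_linear.tendsto[OF bounded_linear_ip_left y])
    have "ip (S n) (b j) = c j" if "n > j" for n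
    proof -
      have "ip (S n) (b j) = (\<Sum>i<n. if i = j then c j else 0)"
        unfolding S_def ip_sum_left using zero[of j] unit_or_zero[of j]
        by (intro sum.cong) (auto simp: ip_scale_left ip_self orthogonal)
      with that show ?thesis by simp
    qed
    then show "(\<lambda>n. ip (S n) (b j)) \<longlonglongrightarrow> c j"
      by (intro tendsto_eventually eventually_mono[OF eventually_gt_at_top[of j]])
  qed
  then show ?thesis by blast
qed

lemma riesz_representation:
  assumes lin: "Vector_Spaces.linear sc (*) f" and cont: "continuous_on UNIV f"
  shows "\<exists>y. \<forall>x. f x = ip x y"
proof -
  have add: "f (x + y) = f x + f y" and scale: "f (sc c x) = c * f x" for x y c
    using lin by (auto simp: linear_functional_iff)
  have bl: "bounded_linear f" by (rule continuous_functional_bounded_linear[OF lin cont])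
  then obtain C where C: "\<And>x. norm (f x) \<le> norm x * C" using bounded_linear.bounded by blast
  have "(\<Sum>i<n. (norm (f (b i)))\<^sup>2) \<le> C\<^sup>2" for n
    using C by (intro bessel add scale) (simp add: mult.commute)
  moreover have "f 0 = 0" using add[of 0 0] by simp
  ultimately obtain y where y: "\<And>i. ip y (b i) = kcnj (f (b i))"
    using riesz_fischer[of "\<lambda>i. kcnj (f (b i))" "C\<^sup>2"] by auto
  have "{x. f x = ip x y} = UNIV"
  proof (rule closed_subspace_eq_UNIV)
    show "subspace {x. f x = ip x y}"
      using \<open>f 0 = 0\<close> by (intro subspaceI) (auto simp: add scale ip_add_left ip_scale_left)
    show "closed {x. f x = ip x y}"
      by (intro closed_Collect_eq cont
          bounded_linear.continuous_on[OF bounded_linear_ip_left continuous_on_id])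
    have "f (b i) = ip (b i) y" for i using y[of i] ip_commute[of "b i" y] by simp
    then show "range b \<subseteq> {x. f x = ip x y}" by auto
  qed
  then show ?thesis by blast
qed

text \<open>By the Riesz representation weak convergence can be tested against vectors \<open>y\<close>; the good \<open>y\<close> form a
  subspace, which is closed because the sequence is bounded.\<close>

lemma weak_convergence_from_coordinates:
  assumes bound: "\<And>n. norm (u n) \<le> R"
    and coord: "\<And>i. (\<lambda>n. ip (u n) (b i)) \<longlonglongrightarrow> ip l (b i)"
  shows "weakly_converges sc u l"
proof -
  define w where "w n = u n - l" for n
  define R' where "R' = R + norm l + 1"
  have wR: "norm (w n) \<le> R'" for n
    using bound[of n] norm_triangle_ineq4[of "u n" l] by (simp add: w_def R'_def)
  have "0 \<le> R" using bound[of 0] norm_ge_zero[of "u 0"] by linarith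
  then have "R' > 0" using norm_ge_zero[of l] unfolding R'_def by linarith
  let ?S = "{y. (\<lambda>n. ip (w n) y) \<longlonglongrightarrow> 0}"
  have "?S = UNIV"
  proof (rule closed_subspace_eq_UNIV)
    show "subspace ?S"
      by (intro subspaceI)
        (auto simp: ip_add_right ip_scale_right intro: tendsto_add_zero tendsto_mult_right_zero)
    show "range b \<subseteq> ?S"
      using coord by (auto simp: w_def ip_diff_left intro: LIM_zero)
    show "closed ?S"
      unfolding closed_def[symmetric] closure_subset_eq[symmetric]
    proof (intro subsetI CollectI tendstoI)
      fix y and \<epsilon> :: real assume y: "y \<in> closure ?S" and "\<epsilon> > 0"
      then have "\<epsilon> / (2 * R') > 0" using \<open>R' > 0\<close> by simp
      then obtain s where s: "s \<in> ?S" "dist s y < \<epsilon> / (2 * R')"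
        using y unfolding closure_approachable by blast
      have "\<forall>\<^sub>F n in sequentially. dist (ip (w n) s) 0 < \<epsilon> / 2"
        using s(1) \<open>\<epsilon> > 0\<close> by (intro tendstoD) auto
      then show "\<forall>\<^sub>F n in sequentially. dist (ip (w n) y) 0 < \<epsilon>"
      proof eventually_elim
        case (elim n)
        have "norm (ip (w n) (y - s)) \<le> norm (w n) * norm (y - s)" by (rule cauchy_schwarz)
        also have "\<dots> \<le> R' * (\<epsilon> / (2 * R'))"
          using s(2) wR[of n] \<open>R' > 0\<close>
          by (intro mult_mono) (auto simp: dist_norm norm_minus_commute)
        also have "\<dots> = \<epsilon> / 2" using \<open>R' > 0\<close> by simp
        finally have "norm (ip (w n) (y - s)) \<le> \<epsilon> / 2" .
        moreover have "ip (w n) y = ip (w n) (y - s) + ip (w n) s" by (simp add: ip_diff_right)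
        ultimately show ?case
          using elim norm_triangle_ineq[of "ip (w n) (y - s)" "ip (w n) s"] by simp
      qed
    qed
  qed
  then have lim: "(\<lambda>n. ip (u n) y) \<longlonglongrightarrow> ip l y" for y
    using LIM_zero_cancel[of "\<lambda>n. ip (u n) y" "ip l y"] by (auto simp: w_def ip_diff_left)
  show ?thesis
    unfolding weakly_converges_def
  proof (intro allI impI, elim conjE)
    fix f assume "Vector_Spaces.linear sc (*) f" "continuous_on UNIV f"
    then obtain y where "\<And>x. f x = ip x y" using riesz_representation by blast
    then show "(\<lambda>n. f (u n)) \<longlonglongrightarrow> f l" using lim by simp
  qed
qed

text \<open>A diagonal argument makes all coordinates converge along one subsequence. By Bessel's inequality the
  coordinate limits are square summable, so they are the coordinates of a vector, the weak limit.\<close>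

lemma bounded_imp_weakly_convergent_subsequence:
  fixes u :: "nat \<Rightarrow> 'v"
  assumes bound: "\<And>n. norm (u n) \<le> R"
  shows "\<exists>l r. strict_mono r \<and> weakly_converges sc (u \<circ> r) l"
proof -
  \<comment> \<open>The \<open>i\<close>-th property of the diagonal construction: the \<open>i\<close>-th coordinate converges along \<open>s\<close>.\<close>
  interpret subseqs "\<lambda>i (s :: nat \<Rightarrow> nat). convergent (\<lambda>n. ip (u (s n)) (b i))"
  proof unfold_locales
    fix i and s :: "nat \<Rightarrow> nat"
    have "norm (ip (u (s n)) (b i)) \<le> R" for n
    proof -
      have "norm (ip (u (s n)) (b i)) \<le> norm (u (s n)) * 1"
        using unit_or_zero[of i]
        by (intro order_trans[OF cauchy_schwarz] mult_left_mono) auto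
      with bound[of "s n"] show ?thesis by linarith
    qed
    from scalar_bounded_subsequence[of "\<lambda>n. ip (u (s n)) (b i)", OF this]
    show "\<exists>r'. strict_mono r' \<and> convergent (\<lambda>n. ip (u ((s \<circ> r') n)) (b i))"
      by (auto simp: convergent_def o_def)
  qed
  have "convergent (\<lambda>n. ip (u (diagseq n)) (b i))" for i
  proof -
    have "convergent (\<lambda>n. ip (u ((diagseq \<circ> ((+) (Suc i))) n)) (b i))"
    proof (rule diagseq_holds)
      fix r s :: "nat \<Rightarrow> nat" and n
      assume "strict_mono r" "convergent (\<lambda>k. ip (u (s k)) (b n))"
      then show "convergent (\<lambda>k. ip (u ((s \<circ> r) k)) (b n))"
        using convergent_subseq_convergent[of "\<lambda>k. ip (u (s k)) (b n)" r] by (simp add: o_def)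
    qed
    then have "convergent (\<lambda>n. ip (u (diagseq (n + Suc i))) (b i))"
      unfolding o_def by (subst add.commute)
    then show ?thesis
      using convergent_ignore_initial_segment[of "\<lambda>n. ip (u (diagseq n)) (b i)" "Suc i"] by blast
  qed
  then obtain c where c: "\<And>i. (\<lambda>n. ip (u (diagseq n)) (b i)) \<longlonglongrightarrow> c i"
    by (meson convergent_LIMSEQ_iff)
  have "(\<Sum>i<n. (norm (c i))\<^sup>2) \<le> R\<^sup>2" for n
  proof (rule LIMSEQ_le_const2)
    show "(\<lambda>k. \<Sum>i<n. (norm (ip (u (diagseq k)) (b i)))\<^sup>2) \<longlonglongrightarrow> (\<Sum>i<n. (norm (c i))\<^sup>2)"
      by (intro tendsto_intros c)
    have "(\<Sum>i<n. (norm (ip (b i) (u k)))\<^sup>2) \<le> R\<^sup>2" for k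
    proof (rule bessel)
      show "norm (ip x (u k)) \<le> R * norm x" for x
        using cauchy_schwarz[of x "u k"] mult_left_mono[OF bound[of k] norm_ge_zero[of x]]
        by (simp add: mult.commute)
    qed (simp_all add: ip_add_left ip_scale_left)
    then show "\<exists>N. \<forall>k\<ge>N. (\<Sum>i<n. (norm (ip (u (diagseq k)) (b i)))\<^sup>2) \<le> R\<^sup>2"
      by (simp add: norm_ip_commute[of _ "b _"])
  qed
  moreover have "c i = 0" if "b i = 0" for i
    using c[of i] that by (simp add: LIMSEQ_const_iff)
  ultimately obtain l where l: "\<And>i. ip l (b i) = c i"
    using riesz_fischer[of c "R\<^sup>2"] by auto
  have "weakly_converges sc (u \<circ> diagseq) l"
    using bound c by (intro weak_convergence_from_coordinates[of _ R]) (auto simp: l)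
  then show ?thesis using subseq_diagseq by blast
qed

end

section \<open>Galerkin approximation of a continuous form\<close>

lemma (in hilbert_space) antilinear_eq_on_span:
  assumes "antilinear sc f" "antilinear sc g" and eq: "\<And>x. x \<in> B \<Longrightarrow> f x = g x" and v: "v \<in> span B"
  shows "f v = g v"
  using v
proof (induction rule: span_induct_alt)
  case base
  have "f (0 + 0) = f 0 + f 0" "g (0 + 0) = g 0 + g 0"
    using assms(1,2) unfolding antilinear_def by blast+
  then show ?case by simp
qed (use assms(1,2) eq in \<open>simp add: antilinear_def\<close>)

text \<open>With a basis \<open>B\<close> of \<open>W\<close>, the map \<open>T u = (\<Sum>c\<in>B. a u c * c)\<close> of \<open>W\<close> into itself records the values
  of \<open>a u\<close> on \<open>B\<close> as coordinates. Solving the problem for \<open>L\<close> means hitting the vector with coordinates \<open>L c\<close>, and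
  an injective linear map of a finite-dimensional space into itself is onto.\<close>

lemma (in hilbert_space) finite_dimensional_solvability:
  assumes sesq: "sesquilinear sc a" and W: "fin_dim_subspace sc W"
    and inj: "\<And>u. u \<in> W \<Longrightarrow> (\<forall>v\<in>W. a u v = 0) \<Longrightarrow> u = 0"
    and L: "antilinear sc L"
  shows "\<exists>w. solves_in a L W w"
proof -
  obtain B0 where B0: "finite B0" "W = span B0" and "subspace W"
    using W unfolding fin_dim_subspace_def by blast
  obtain B where B: "B \<subseteq> W" "independent B" "W \<subseteq> span B"
    using maximal_independent_subset by blast
  have finB: "finite B" using independent_span_bound[OF B0(1) B(2)] B(1) B0(2) by simp
  have spanB: "span B = W" using B span_minimal[OF B(1) \<open>subspace W\<close>] by blast
  have lin: "Vector_Spaces.linear sc (*) (\<lambda>u. a u v)" and anti: "antilinear sc (a u)" for u v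
    using sesq unfolding sesquilinear_def by blast+
  define T where "T u = (\<Sum>c\<in>B. sc (a u c) c)" for u
  have T_linear: "Vector_Spaces.linear sc sc T"
    using lin vector_space_axioms unfolding linear_functional_iff
    by (simp add: Vector_Spaces.linear_iff T_def scale_left_distrib sum.distrib scale_sum_right)
  interpret p: vector_space_pair sc sc by unfold_locales
  \<comment> \<open>Coordinates are unique, so \<open>T u\<close> determines \<open>a u\<close> on \<open>B\<close> and hence on \<open>W\<close>.\<close>
  have T_eqD: "a u v = L' v" if "T u = (\<Sum>c\<in>B. sc (L' c) c)" "antilinear sc L'" "v \<in> W" for u L' v
  proof (rule antilinear_eq_on_span[OF anti that(2)])
    fix c assume "c \<in> B"
    have "(\<Sum>c\<in>B. sc (a u c - L' c) c) = 0"
      using that(1) by (simp add: T_def scale_left_diff_distrib sum_subtractf)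
    then have "a u c - L' c = 0"
      by (rule independentD[OF B(2) finB order_refl _ \<open>c \<in> B\<close>])
    then show "a u c = L' c" by simp
  qed (use that(3) spanB in simp)
  have T_ker: "u = 0" if "u \<in> W" "T u = 0" for u
  proof (rule inj[OF that(1)], intro ballI)
    have "antilinear sc (\<lambda>_. 0)" by (simp add: antilinear_def)
    then show "a u v = 0" if "v \<in> W" for v
      by (rule T_eqD[rotated, OF _ that]) (simp add: \<open>T u = 0\<close>)
  qed
  have inj_T: "inj_on T (span B)"
    unfolding p.linear_inj_on_iff_eq_0[OF T_linear subspace_span[of B]] using T_ker spanB by simp
  have indep: "independent (T ` B)"
    by (rule p.linear_independent_injective_image[OF T_linear B(2) inj_T])
  have cardT: "card (T ` B) = card B"
    by (rule card_image[OF inj_on_subset[OF inj_T span_superset]])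
  have T_in: "T u \<in> W" for u
    unfolding T_def spanB[symmetric] by (intro span_sum span_scale span_base)
  \<comment> \<open>Otherwise \<open>T ` B\<close> could be enlarged to an independent set with more elements than \<open>B\<close>.\<close>
  have "W \<subseteq> span (T ` B)"
  proof (rule ccontr)
    assume "\<not> W \<subseteq> span (T ` B)"
    then obtain x where x: "x \<in> W" "x \<notin> span (T ` B)" by blast
    then have "card (insert x (T ` B)) \<le> card B"
      using independent_span_bound[OF finB independent_insertI[OF x(2) indep]] T_in spanB by auto
    moreover have "x \<notin> T ` B" using x(2) span_base by blast
    ultimately show False using cardT finB by simp
  qed
  then have "W \<subseteq> T ` W"
    using p.linear_span_image[OF T_linear, of B] spanB by simp
  moreover have "(\<Sum>c\<in>B. sc (L c) c) \<in> W"
    unfolding spanB[symmetric] by (intro span_sum span_scale span_base)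
  ultimately have "(\<Sum>c\<in>B. sc (L c) c) \<in> T ` W" by (rule subsetD)
  then obtain w where "w \<in> W" "T w = (\<Sum>c\<in>B. sc (L c) c)" by (elim imageE) simp
  then have "solves_in a L W w" unfolding solves_in_def using T_eqD[OF _ L] by simp
  then show ?thesis by (rule exI)
qed

locale bounded_form = separable_hilbert_space sc ip b
  for sc :: "'k::real_or_complex \<Rightarrow> 'v::banach \<Rightarrow> 'v" and ip b +
  fixes a :: "'v \<Rightarrow> 'v \<Rightarrow> 'k" and M :: real
  assumes sesquilinear: "sesquilinear sc a"
    and M_pos: "M > 0"
    and form_bound: "norm (a u v) \<le> M * norm u * norm v"
begin

lemma form_add_left: "a (u + u') v = a u v + a u' v"
  and form_scale_left: "a (sc c u) v = c * a u v"
  and form_add_right: "a u (v + v') = a u v + a u v'"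
  and form_scale_right: "a u (sc c v) = kcnj c * a u v"
  using sesquilinear unfolding sesquilinear_def linear_functional_iff antilinear_def by blast+

lemma form_diff_left: "a (u - u') v = a u v - a u' v"
  using form_add_left[of "u - u'" u' v] by simp

lemma form_diff_right: "a u (v - v') = a u v - a u v'"
  using form_add_right[of u "v - v'" v'] by simp

lemma form_zero_left [simp]: "a 0 v = 0"
  using form_diff_left[of 0 0 v] by simp

lemma form_sum_left: "a (\<Sum>i\<in>A. f i) v = (\<Sum>i\<in>A. a (f i) v)"
  by (induction A rule: infinite_finite_induct) (auto simp: form_add_left)

lemma form_left_bounded_linear: "bounded_linear (\<lambda>u. a u v)"
proof (rule bounded_linear_intro)
  show "a (r *\<^sub>R u) v = r *\<^sub>R a u v" for r u
    by (simp flip: scale_of_real add: form_scale_left scaleR_conv_of_real)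
  show "norm (a u v) \<le> norm u * (M * norm v)" for u
    using form_bound[of u v] by (simp add: mult.left_commute mult.assoc)
qed (rule form_add_left)

lemma form_weakly_continuous_left:
  assumes "weakly_converges sc u l"
  shows "(\<lambda>n. a (u n) v) \<longlonglongrightarrow> a l v"
proof -
  have "Vector_Spaces.linear sc (*) (\<lambda>x. a x v)"
    by (simp add: linear_functional_iff form_add_left form_scale_left)
  moreover have "continuous_on UNIV (\<lambda>x. a x v)"
    by (rule bounded_linear.continuous_on[OF form_left_bounded_linear continuous_on_id])
  ultimately show ?thesis using assms unfolding weakly_converges_def by blast
qed

text \<open>Weak convergence is tested by linear functionals, and the form is antilinear in this argument, so the
  functional to use is the conjugate \<open>x \<mapsto> kcnj (a v x)\<close>.\<close>

lemma form_weakly_null_right: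
  assumes "weakly_converges sc u 0"
  shows "(\<lambda>n. norm (a v (u n))) \<longlonglongrightarrow> 0"
proof -
  have bl: "bounded_linear (\<lambda>x. kcnj (a v x))"
  proof (rule bounded_linear_intro)
    show "kcnj (a v (r *\<^sub>R x)) = r *\<^sub>R kcnj (a v x)" for r x
      by (simp flip: scale_of_real add: form_scale_right kcnj_mult scaleR_conv_of_real)
    show "norm (kcnj (a v x)) \<le> norm x * (M * norm v)" for x
      using form_bound[of v x] by (simp add: ac_simps)
  qed (simp add: form_add_right kcnj_add)
  have "Vector_Spaces.linear sc (*) (\<lambda>x. kcnj (a v x))"
    by (simp add: linear_functional_iff form_add_right form_scale_right kcnj_add kcnj_mult)
  moreover have "continuous_on UNIV (\<lambda>x. kcnj (a v x))"
    by (rule bounded_linear.continuous_on[OF bl continuous_on_id])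
  ultimately have "(\<lambda>n. kcnj (a v (u n))) \<longlonglongrightarrow> kcnj (a v 0)"
    using assms unfolding weakly_converges_def by blast
  moreover have "a v 0 = 0" using form_diff_right[of v 0 0] by simp
  ultimately show ?thesis using tendsto_norm by fastforce
qed

text \<open>The discrete inf-sup condition. A bound \<open>\<eta>\<close> for the norm of \<open>a u\<close> on \<open>W\<close> stands in for the supremum over the
  unit sphere of \<open>W\<close>, which is empty for \<open>W = {0}\<close>; for this case \<open>\<eta>\<close> has to be nonnegative.\<close>

definition inf_sup_on :: "real \<Rightarrow> 'v set \<Rightarrow> bool" where
  "inf_sup_on \<beta> W \<longleftrightarrow>
     (\<forall>u\<in>W. \<forall>\<eta>\<ge>0. (\<forall>v\<in>W. norm (a u v) \<le> \<eta> * norm v) \<longrightarrow> \<beta> * norm u \<le> \<eta>)"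

lemma inf_sup_onD:
  "inf_sup_on \<beta> W \<Longrightarrow> u \<in> W \<Longrightarrow> 0 \<le> \<eta> \<Longrightarrow> (\<And>v. v \<in> W \<Longrightarrow> norm (a u v) \<le> \<eta> * norm v)
    \<Longrightarrow> \<beta> * norm u \<le> \<eta>"
  unfolding inf_sup_on_def by blast

lemma inf_sup_unique_solution:
  assumes "inf_sup_on \<beta> W" "\<beta> > 0" "fin_dim_subspace sc W" "L \<in> antidual sc"
  shows "\<exists>!w. solves_in a L W w"
proof -
  have sub: "subspace W" using assms(3) by (simp add: fin_dim_subspace_def)
  have inj: "u = 0" if "u \<in> W" "\<forall>v\<in>W. a u v = 0" for u
  proof -
    have "\<beta> * norm u \<le> 0" using that by (intro inf_sup_onD[OF assms(1)]) auto
    then show ?thesis using assms(2) by (simp add: mult_le_0_iff)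
  qed
  obtain w where w: "solves_in a L W w"
    using finite_dimensional_solvability[OF sesquilinear assms(3) inj] assms(4)
    unfolding antidual_def by blast
  have "w' = w" if "solves_in a L W w'" for w'
  proof -
    have "w' - w \<in> W" using that w sub by (auto simp: solves_in_def intro: subspace_diff)
    moreover have "\<forall>v\<in>W. a (w' - w) v = 0"
      using that w by (auto simp: solves_in_def form_diff_left)
    ultimately show ?thesis using inj[of "w' - w"] by simp
  qed
  with w show ?thesis by blast
qed

text \<open>Cea's argument: \<open>w - x\<close> lies in \<open>W\<close>, where \<open>a (w - x)\<close> and \<open>a (u - x)\<close> coincide because \<open>u\<close> and \<open>w\<close> solve
  the same equations there. The inf-sup condition turns this into \<open>\<beta> * norm (w - x) \<le> M * norm (u - x)\<close>.\<close>

lemma inf_sup_quasi_optimal: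
  assumes "inf_sup_on \<beta> W" "\<beta> > 0" "subspace W"
    and u: "solves_in a L UNIV u" and w: "solves_in a L W w"
  shows "norm (u - w) \<le> (1 + M / \<beta>) * infdist u W"
proof (rule linear_le_infdistI)
  show "W \<noteq> {}" using w by (auto simp: solves_in_def)
  show "1 + M / \<beta> > 0" using M_pos assms(2) by (simp add: add_pos_pos)
  fix x assume x: "x \<in> W"
  have "\<beta> * norm (w - x) \<le> M * norm (u - x)"
  proof (rule inf_sup_onD[OF assms(1)])
    show "w - x \<in> W" using w x assms(3) by (auto simp: solves_in_def intro: subspace_diff)
    show "0 \<le> M * norm (u - x)" using M_pos by simp
    fix v assume "v \<in> W"
    then have "a (w - x) v = a (u - x) v" using u w by (simp add: solves_in_def form_diff_left)
    then show "norm (a (w - x) v) \<le> M * norm (u - x) * norm v" by (simp add: form_bound)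
  qed
  then have "norm (w - x) \<le> M / \<beta> * norm (u - x)"
    using assms(2) by (simp add: field_simps)
  moreover have "norm (u - w) \<le> norm (u - x) + norm (w - x)"
    using norm_triangle_ineq4[of "u - x" "w - x"] by simp
  ultimately show "norm (u - w) \<le> (1 + M / \<beta>) * dist u x"
    by (simp add: dist_norm distrib_right)
qed

text \<open>If the condition failed, almost degenerate unit vectors in the spaces \<open>V n\<close> would have a weak limit that uniqueness forces to be \<open>0\<close>, and essential coercivity
  would then make them converge to \<open>0\<close> in norm.\<close>

lemma uniform_inf_sup:
  assumes ec: "essentially_coercive sc a" and uniq: "satisfies_uniqueness a"
    and V: "approximating_sequence sc V"
  shows "\<exists>n\<^sub>0\<ge>1. \<exists>\<beta>>0. \<forall>n\<ge>n\<^sub>0. inf_sup_on \<beta> (V n)"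
proof (rule ccontr)
  assume neg: "\<not> ?thesis"
  have "\<exists>N e. N \<ge> k \<and> e \<in> V N \<and> norm e = 1 \<and>
      (\<forall>v\<in>V N. norm (a e v) \<le> norm v / (real k + 1))" for k
  proof -
    define \<beta> where "\<beta> = 1 / (real k + 1)"
    have \<beta>: "\<beta> > 0" by (simp add: \<beta>_def)
    have "\<not> (\<forall>n\<ge>Suc k. inf_sup_on \<beta> (V n))" using neg \<beta> by auto
    then obtain N u \<eta> where N: "N \<ge> Suc k" and u: "u \<in> V N" "\<eta> \<ge> 0" "\<not> \<beta> * norm u \<le> \<eta>"
      "\<And>v. v \<in> V N \<Longrightarrow> norm (a u v) \<le> \<eta> * norm v"
      unfolding inf_sup_on_def by blast
    have "subspace (V N)"
      using V N by (auto simp: approximating_sequence_def fin_dim_subspace_def)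
    define e where "e = sc (of_real (inverse (norm u))) u"
    have "norm u > 0" using u(2,3) \<beta> by auto
    have "e \<in> V N" unfolding e_def by (intro subspace_scale \<open>subspace (V N)\<close> u(1))
    moreover have "norm e = 1" using \<open>norm u > 0\<close> by (simp add: e_def norm_scale norm_inverse)
    moreover have "norm (a e v) \<le> norm v / (real k + 1)" if "v \<in> V N" for v
    proof -
      have "norm (a u v) \<le> (\<beta> * norm u) * norm v"
        using u(4)[OF that] u(3) by (smt (verit) mult_right_mono norm_ge_zero)
      moreover have "norm (a e v) = norm (a u v) / norm u"
        by (simp add: e_def form_scale_left norm_mult divide_inverse mult.commute del: of_real_inverse)
      ultimately have "norm (a e v) \<le> \<beta> * norm u * norm v / norm u"
        by (simp only: divide_right_mono[OF _ norm_ge_zero])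
      also have "\<dots> = norm v / (real k + 1)" using \<open>norm u > 0\<close> by (simp add: \<beta>_def)
      finally show ?thesis .
    qed
    ultimately show ?thesis using N by (intro exI[of _ N] exI[of _ e]) auto
  qed
  then have "\<forall>k. \<exists>p. fst p \<ge> k \<and> snd p \<in> V (fst p) \<and> norm (snd p) = 1 \<and>
      (\<forall>v\<in>V (fst p). norm (a (snd p) v) \<le> norm v / (real k + 1))"
    by (simp only: split_paired_Ex fst_conv snd_conv) blast
  from choice[OF this] obtain p where p: "\<And>k. fst (p k) \<ge> k \<and> snd (p k) \<in> V (fst (p k)) \<and>
      norm (snd (p k)) = 1 \<and> (\<forall>v\<in>V (fst (p k)). norm (a (snd (p k)) v) \<le> norm v / (real k + 1))"
    by (elim exE) blast
  define N e where "N k = fst (p k)" and "e k = snd (p k)" for k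
  have N: "\<And>k. N k \<ge> k" and e: "\<And>k. e k \<in> V (N k)"
      "\<And>k. norm (e k) = 1" "\<And>k v. v \<in> V (N k) \<Longrightarrow> norm (a (e k) v) \<le> norm v / (real k + 1)"
    using p by (auto simp: N_def e_def)
  \<comment> \<open>Approximate \<open>v\<close> by \<open>x\<close> in \<open>V (N k)\<close>; taking the infimum over \<open>x\<close> avoids a choice of approximants.\<close>
  have null: "(\<lambda>k. a (e k) v) \<longlonglongrightarrow> 0" for v
  proof (rule Lim_null_comparison)
    show "\<forall>\<^sub>F k in sequentially.
        norm (a (e k) v) \<le> (M + 1) * infdist v (V (N k)) + norm v / (real k + 1)"
    proof (intro always_eventually allI)
      fix k
      have "norm (a (e k) v) - norm v / (real k + 1) \<le> (M + 1) * infdist v (V (N k))"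
      proof (rule linear_le_infdistI)
        show "V (N k) \<noteq> {}" using e(1) by blast
        show "M + 1 > 0" using M_pos by simp
        fix x assume x: "x \<in> V (N k)"
        have "norm (a (e k) (v - x)) \<le> M * norm (v - x)" using form_bound[of "e k" "v - x"] e(2) by simp
        moreover have "norm (a (e k) x) \<le> norm v / (real k + 1) + norm (v - x)"
        proof -
          have "norm (a (e k) x) \<le> (norm v + norm (v - x)) / (real k + 1)"
            using norm_triangle_ineq4[of v "v - x"]
            by (intro order_trans[OF e(3)[OF x]] divide_right_mono) auto
          also have "\<dots> \<le> norm v / (real k + 1) + norm (v - x)"
            by (simp add: add_divide_distrib divide_le_eq distrib_left)
          finally show ?thesis .
        qed
        moreover have "norm (a (e k) v) \<le> norm (a (e k) (v - x)) + norm (a (e k) x)"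
          using norm_triangle_ineq[of "a (e k) (v - x)" "a (e k) x"] by (simp add: form_diff_right)
        ultimately show "norm (a (e k) v) - norm v / (real k + 1) \<le> (M + 1) * dist v x"
          by (simp add: dist_norm distrib_right)
      qed
      then show "norm (a (e k) v) \<le> (M + 1) * infdist v (V (N k)) + norm v / (real k + 1)" by simp
    qed
    have "filterlim N at_top sequentially"
      by (rule filterlim_at_top_mono[OF filterlim_ident]) (use N in auto)
    then have "(\<lambda>k. infdist v (V (N k))) \<longlonglongrightarrow> 0"
      using V filterlim_compose[of "\<lambda>n. infdist v (V n)"] unfolding approximating_sequence_def by blast
    moreover have "(\<lambda>k. norm v / (real k + 1)) \<longlonglongrightarrow> 0"
      using tendsto_mult_right_zero[OF LIMSEQ_inverse_real_of_nat, of "norm v"]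
      by (simp add: divide_inverse add.commute)
    ultimately show "(\<lambda>k. (M + 1) * infdist v (V (N k)) + norm v / (real k + 1)) \<longlonglongrightarrow> 0"
      by (intro tendsto_add_zero tendsto_mult_right_zero)
  qed
  obtain l r where r: "strict_mono r" and wl: "weakly_converges sc (e \<circ> r) l"
    using bounded_imp_weakly_convergent_subsequence[of e 1] e(2) by auto
  have "a l v = 0" for v
  proof (rule LIMSEQ_unique)
    show "(\<lambda>n. a ((e \<circ> r) n) v) \<longlonglongrightarrow> a l v" by (rule form_weakly_continuous_left[OF wl])
    show "(\<lambda>n. a ((e \<circ> r) n) v) \<longlonglongrightarrow> 0"
      using LIMSEQ_subseq_LIMSEQ[OF null r] by (simp add: o_def)
  qed
  then have "l = 0" using uniq by (simp add: satisfies_uniqueness_def)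
  have "(\<lambda>k. a (e k) (e k)) \<longlonglongrightarrow> 0"
  proof (rule Lim_null_comparison)
    show "\<forall>\<^sub>F k in sequentially. norm (a (e k) (e k)) \<le> 1 / (real k + 1)"
    proof (intro always_eventually allI)
      show "norm (a (e k) (e k)) \<le> 1 / (real k + 1)" for k using e(3)[OF e(1)[of k]] e(2) by simp
    qed
    show "(\<lambda>k. 1 / (real k + 1)) \<longlonglongrightarrow> 0"
      using LIMSEQ_inverse_real_of_nat by (simp add: divide_inverse add.commute)
  qed
  from LIMSEQ_subseq_LIMSEQ[OF this r]
  have "(\<lambda>n. a ((e \<circ> r) n) ((e \<circ> r) n)) \<longlonglongrightarrow> 0" by (simp add: o_def)
  then have "(\<lambda>n. norm ((e \<circ> r) n)) \<longlonglongrightarrow> 0"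
    using ec wl \<open>l = 0\<close> unfolding essentially_coercive_def by blast
  then show False by (simp add: e(2) LIMSEQ_const_iff)
qed

lemma finite_span_fin_dim: "finite B \<Longrightarrow> fin_dim_subspace sc (span B)"
  unfolding fin_dim_subspace_def by auto

lemma basis_approximating_sequence: "approximating_sequence sc (\<lambda>n. span (b ` {..<n}))"
  unfolding approximating_sequence_def using total by (simp add: finite_span_fin_dim)

text \<open>The inf-sup condition bounds the discrete solutions by the norm of \<open>L\<close> divided by \<open>\<beta>\<close>. A weak limit
  \<open>u\<close> of them satisfies every equation \<open>a u v = L v\<close>, since \<open>v\<close> is approximated by test vectors
  for which the discrete equations hold.\<close>

lemma full_solution_exists:
  assumes ec: "essentially_coercive sc a" and uniq: "satisfies_uniqueness a"
    and L: "L \<in> antidual sc"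
  shows "\<exists>u. solves_in a L UNIV u"
proof -
  define V where "V n = span (b ` {..<n})" for n
  have V: "approximating_sequence sc V" unfolding V_def by (rule basis_approximating_sequence)
  obtain n0 \<beta> where n0: "n0 \<ge> 1" and \<beta>: "\<beta> > 0" and stab: "\<And>n. n \<ge> n0 \<Longrightarrow> inf_sup_on \<beta> (V n)"
    using uniform_inf_sup[OF ec uniq V] by blast
  have fin: "fin_dim_subspace sc (V n)" for n unfolding V_def by (simp add: finite_span_fin_dim)
  interpret L: bounded_linear L by (rule antidual_bounded_linear[OF L])
  obtain C where C: "C \<ge> 0" "\<And>x. norm (L x) \<le> norm x * C"
    using L.nonneg_bounded by blast
  define w where "w k = (THE w. solves_in a L (V (n0 + k)) w)" for k
  have w: "solves_in a L (V (n0 + k)) (w k)" for k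
    unfolding w_def by (rule theI', rule inf_sup_unique_solution[OF stab \<beta> fin L]) simp
  have bound: "norm (w k) \<le> C / \<beta>" for k
  proof -
    have "\<beta> * norm (w k) \<le> C"
      using w[of k] C by (intro inf_sup_onD[OF stab, of "n0 + k"])
        (auto simp: solves_in_def mult.commute)
    then show ?thesis using \<beta> by (simp add: field_simps)
  qed
  obtain u r where r: "strict_mono r" and wu: "weakly_converges sc (w \<circ> r) u"
    using bounded_imp_weakly_convergent_subsequence[of w, OF bound] by blast
  have "a u v = L v" for v
  proof (rule LIMSEQ_unique)
    show "(\<lambda>n. a ((w \<circ> r) n) v) \<longlonglongrightarrow> a u v" by (rule form_weakly_continuous_left[OF wu])
    let ?K = "M * (C / \<beta>) + C + 1"
    have K: "?K > 0" using M_pos \<beta> C(1) by (simp add: add_nonneg_pos)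
    have "(\<lambda>k. a (w k) v - L v) \<longlonglongrightarrow> 0"
    proof (rule Lim_null_comparison)
      show "\<forall>\<^sub>F k in sequentially. norm (a (w k) v - L v) \<le> ?K * infdist v (V (n0 + k))"
      proof (intro always_eventually allI linear_le_infdistI K)
        fix k x
        show "V (n0 + k) \<noteq> {}" using w[of k] by (auto simp: solves_in_def)
        assume "x \<in> V (n0 + k)"
        then have "a (w k) x = L x" using w[of k] by (simp add: solves_in_def)
        then have eq: "a (w k) v - L v = a (w k) (v - x) - L (v - x)"
          by (simp add: form_diff_right L.diff)
        have "norm (a (w k) (v - x)) \<le> M * (C / \<beta>) * norm (v - x)"
          using M_pos by (intro order_trans[OF form_bound] mult_mono bound) (use \<beta> C(1) in auto)
        moreover have "norm (L (v - x)) \<le> C * norm (v - x)" using C(2) by (simp add: mult.commute)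
        ultimately have "norm (a (w k) v - L v) \<le> (M * (C / \<beta>) + C) * norm (v - x)"
          unfolding eq distrib_right
          using norm_triangle_ineq4[of "a (w k) (v - x)" "L (v - x)"] by linarith
        also have "\<dots> \<le> ?K * norm (v - x)" by (intro mult_right_mono) auto
        finally show "norm (a (w k) v - L v) \<le> ?K * dist v x" by (simp add: dist_norm)
      qed
      have "(\<lambda>k. infdist v (V (n0 + k))) \<longlonglongrightarrow> 0"
        using LIMSEQ_ignore_initial_segment[of "\<lambda>n. infdist v (V n)" 0 n0] V
        unfolding approximating_sequence_def by (simp add: add.commute)
      then show "(\<lambda>k. ?K * infdist v (V (n0 + k))) \<longlonglongrightarrow> 0"
        by (rule tendsto_mult_right_zero)
    qed
    then have "(\<lambda>k. a (w k) v) \<longlonglongrightarrow> L v" by (rule LIM_zero_cancel)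
    from LIMSEQ_subseq_LIMSEQ[OF this r]
    show "(\<lambda>n. a ((w \<circ> r) n) v) \<longlonglongrightarrow> L v" by (simp add: o_def)
  qed
  then show ?thesis by (auto simp: solves_in_def)
qed

lemma essentially_coercive_imp_universal_galerkin:
  assumes ec: "essentially_coercive sc a" and uniq: "satisfies_uniqueness a"
  shows "universal_galerkin sc a"
  unfolding universal_galerkin_def
proof (intro conjI ballI allI impI)
  fix L assume L: "L \<in> antidual sc"
  have "u = u'" if "solves_in a L UNIV u" "solves_in a L UNIV u'" for u u'
  proof -
    have "\<forall>v. a (u - u') v = 0" using that by (simp add: solves_in_def form_diff_left)
    then have "u - u' = 0" using uniq unfolding satisfies_uniqueness_def by blast
    then show ?thesis by simp
  qed
  with full_solution_exists[OF assms L] show "\<exists>!u. solves_in a L UNIV u" by blast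
next
  fix V assume V: "approximating_sequence sc V"
  then obtain n0 \<beta> where n0: "n0 \<ge> 1" and \<beta>: "\<beta> > 0"
    and stab: "\<And>n. n \<ge> n0 \<Longrightarrow> inf_sup_on \<beta> (V n)"
    using uniform_inf_sup[OF assms] by blast
  have fin: "fin_dim_subspace sc (V n)" if "n \<ge> n0" for n
    using V n0 that unfolding approximating_sequence_def by simp
  show "\<exists>n\<^sub>0\<ge>1. \<exists>\<gamma>>0. \<forall>L\<in>antidual sc. \<forall>n\<ge>n\<^sub>0. (\<exists>!w. solves_in a L (V n) w) \<and>
      (\<forall>u w. solves_in a L UNIV u \<and> solves_in a L (V n) w \<longrightarrow>
        norm (u - w) \<le> \<gamma> * infdist u (V n))"
  proof (intro exI[of _ n0] exI[of _ "1 + M / \<beta>"] conjI ballI allI impI n0)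
    show "0 < 1 + M / \<beta>" using M_pos \<beta> by (simp add: add_pos_pos)
    fix L n assume L: "L \<in> antidual sc" and n: "n \<ge> n0"
    show "\<exists>!w. solves_in a L (V n) w"
      by (rule inf_sup_unique_solution[OF stab[OF n] \<beta> fin[OF n] L])
    fix u w assume "solves_in a L UNIV u \<and> solves_in a L (V n) w"
    moreover have "subspace (V n)" using fin[OF n] by (simp add: fin_dim_subspace_def)
    ultimately show "norm (u - w) \<le> (1 + M / \<beta>) * infdist u (V n)"
      using inf_sup_quasi_optimal[OF stab[OF n] \<beta>] by blast
  qed
qed

section \<open>The universal Galerkin property forces essential coercivity\<close>

text \<open>Normalise \<open>u k\<close> for a large \<open>k\<close> with \<open>norm (u k) \<ge> \<epsilon>\<close>. By weak convergence \<open>e\<close> is almost orthogonal to the first \<open>n\<close>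
  basis vectors and \<open>a (b i) e\<close> is small for them; \<open>a e e\<close> is small by hypothesis. For
  \<open>v = w + c * e\<close> with \<open>w\<close> in the span of the basis vectors, almost orthogonality bounds both parts by \<open>v\<close>:
  if \<open>ip w e\<close> is at most \<open>norm w / 2\<close>, then \<open>norm c \<le> 3 * norm v\<close> and
  \<open>norm w \<le> 4 * norm v\<close>. This is why a seventh of \<open>\<delta>\<close> is asked of each of the two small quantities.\<close>

lemma almost_degenerate_direction:
  assumes weak: "weakly_converges sc u 0" and diag: "(\<lambda>n. a (u n) (u n)) \<longlonglongrightarrow> 0"
    and not_null: "\<not> (\<lambda>n. norm (u n)) \<longlonglongrightarrow> 0" and \<delta>: "\<delta> > 0"
  shows "\<exists>e. norm e = 1 \<and> (\<forall>v\<in>span (insert e (b ` {..<n})). norm (a v e) \<le> \<delta> * norm v)"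
proof -
  obtain \<epsilon> where \<epsilon>: "\<epsilon> > 0" and large: "\<exists>\<^sub>F k in sequentially. \<epsilon> \<le> norm (u k)"
    using not_null unfolding tendsto_iff not_eventually[symmetric]
    by (auto simp: not_eventually not_less)
  define s where "s k = (\<Sum>i<n. norm (ip (u k) (b i)))" for k
  define t where "t k = (\<Sum>i<n. norm (a (b i) (u k)))" for k
  have "s \<longlonglongrightarrow> (\<Sum>i<n. 0)" unfolding s_def
    using tendsto_norm[OF ip_weakly_continuous[OF weak]] by (intro tendsto_sum) simp
  then have s_small: "\<forall>\<^sub>F k in sequentially. s k < \<epsilon> / 2"
    using \<epsilon> by (intro order_tendstoD(2)) auto
  have "t \<longlonglongrightarrow> (\<Sum>i<n. 0)" unfolding t_def
    by (intro tendsto_sum form_weakly_null_right[OF weak])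
  then have t_small: "\<forall>\<^sub>F k in sequentially. t k < \<delta> / 7 * \<epsilon>"
    using \<epsilon> \<delta> by (intro order_tendstoD(2)) auto
  have "(\<lambda>k. norm (a (u k) (u k))) \<longlonglongrightarrow> 0" using diag tendsto_norm_zero by blast
  then have d_small: "\<forall>\<^sub>F k in sequentially. norm (a (u k) (u k)) < \<delta> / 7 * \<epsilon>\<^sup>2"
    using \<epsilon> \<delta> by (intro order_tendstoD(2)) auto
  from frequently_eventually_conj[OF large eventually_conj[OF s_small eventually_conj[OF t_small d_small]]]
  obtain k where k: "\<epsilon> \<le> norm (u k)" "s k < \<epsilon> / 2" "t k < \<delta> / 7 * \<epsilon>"
      "norm (a (u k) (u k)) < \<delta> / 7 * \<epsilon>\<^sup>2"
    by (auto dest: frequently_ex)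
  define \<rho> where "\<rho> = norm (u k)"
  have \<rho>: "\<rho> \<ge> \<epsilon>" "\<rho> > 0" using k(1) \<epsilon> by (auto simp: \<rho>_def)
  define e where "e = sc (of_real (inverse \<rho>)) (u k)"
  have norm_e: "norm e = 1" using \<rho> by (simp add: e_def norm_scale norm_inverse \<rho>_def)
  have a_e: "norm (a v e) = norm (a v (u k)) / \<rho>" for v
    using \<rho> by (simp add: e_def form_scale_right kcnj_of_real norm_mult divide_inverse mult.commute
        del: of_real_inverse)
  have "s k \<le> \<rho> / 2" "t k \<le> \<delta> / 7 * \<rho>" "norm (a (u k) (u k)) \<le> \<delta> / 7 * \<rho>\<^sup>2"
  proof -
    show "s k \<le> \<rho> / 2" using k(2) \<rho>(1) by simp
    have "\<delta> / 7 * \<epsilon> \<le> \<delta> / 7 * \<rho>" using \<rho>(1) \<delta> by (intro mult_left_mono) auto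
    then show "t k \<le> \<delta> / 7 * \<rho>" using k(3) by simp
    have "\<delta> / 7 * \<epsilon>\<^sup>2 \<le> \<delta> / 7 * \<rho>\<^sup>2" using \<rho>(1) \<delta> \<epsilon> by (intro mult_left_mono power_mono) auto
    then show "norm (a (u k) (u k)) \<le> \<delta> / 7 * \<rho>\<^sup>2" using k(4) by simp
  qed
  note small = this
  have bound: "norm (a v e) \<le> \<delta> * norm v" if v: "v \<in> span (insert e (b ` {..<n}))" for v
  proof -
    obtain c where "v - sc c e \<in> span (b ` {..<n})"
      using v span_breakdown_eq[of v e] by blast
    define w where "w = v - sc c e"
    have w: "w \<in> span (b ` {..<n})" unfolding w_def by fact
    have v_eq: "v = w + sc c e" by (simp add: w_def)
    have w_exp: "w = (\<Sum>i<n. sc (ip w (b i)) (b i))" by (rule span_expansion[OF w])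
    have coef: "norm (ip w (b i)) \<le> norm w" for i
      using cauchy_schwarz[of w "b i"] unit_or_zero[of i] by auto
    have "norm (ip w e) \<le> norm w / 2"
    proof -
      have "ip w (u k) = (\<Sum>i<n. ip w (b i) * ip (b i) (u k))"
        by (subst w_exp) (simp add: ip_sum_left ip_scale_left)
      also have "norm \<dots> \<le> (\<Sum>i<n. norm w * norm (ip (u k) (b i)))"
        by (intro sum_norm_le) (simp add: norm_mult coef mult_right_mono norm_ip_commute[of _ "u k"])
      also have "\<dots> \<le> norm w * (\<rho> / 2)"
        unfolding sum_distrib_left[symmetric] s_def[symmetric] by (intro mult_left_mono small) simp
      finally have "norm (ip w (u k)) \<le> norm w * (\<rho> / 2)" .
      moreover have "norm (ip w e) = norm (ip w (u k)) / \<rho>"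
        using \<rho> by (simp add: e_def ip_scale_right kcnj_of_real norm_mult divide_inverse mult.commute
            del: of_real_inverse)
      ultimately have "norm (ip w e) \<le> norm w * (\<rho> / 2) / \<rho>"
        by (simp only: divide_right_mono[OF _ less_imp_le[OF \<rho>(2)]])
      also have "\<dots> = norm w / 2" using \<rho>(2) by simp
      finally show ?thesis .
    qed
    moreover have "norm (ip w e + c) \<le> norm v"
      using cauchy_schwarz[of v e]
      by (simp add: v_eq ip_add_left ip_scale_left ip_self norm_e)
    moreover have "norm c \<le> norm (ip w e + c) + norm (ip w e)"
      using norm_triangle_ineq4[of "ip w e + c" "ip w e"] by simp
    moreover have "norm w \<le> norm v + norm c"
      using norm_triangle_ineq4[of v "sc c e"] by (simp add: w_def norm_scale norm_e)
    ultimately have c3: "norm c \<le> 3 * norm v" and w4: "norm w \<le> 4 * norm v" by linarith+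
    have "norm (a w e) \<le> 4 * norm v * (\<delta> / 7)"
    proof -
      have "a w (u k) = (\<Sum>i<n. ip w (b i) * a (b i) (u k))"
        by (subst w_exp) (simp add: form_sum_left form_scale_left)
      also have "norm \<dots> \<le> (\<Sum>i<n. norm w * norm (a (b i) (u k)))"
        by (intro sum_norm_le) (simp add: norm_mult coef mult_right_mono)
      also have "\<dots> \<le> norm w * (\<delta> / 7 * \<rho>)"
        unfolding sum_distrib_left[symmetric] t_def[symmetric] by (intro mult_left_mono small) simp
      finally have "norm (a w e) \<le> norm w * (\<delta> / 7)"
        unfolding a_e using \<rho> by (simp add: field_simps)
      also have "\<dots> \<le> 4 * norm v * (\<delta> / 7)" using w4 \<delta> by (intro mult_right_mono) auto
      finally show ?thesis .
    qed
    moreover have "norm (c * a e e) \<le> 3 * norm v * (\<delta> / 7)"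
    proof -
      have "norm (a e (u k)) = norm (a (u k) (u k)) / \<rho>"
        using \<rho> by (simp add: e_def form_scale_left norm_mult divide_inverse mult.commute
            del: of_real_inverse)
      then have "norm (a e e) = norm (a (u k) (u k)) / \<rho>\<^sup>2"
        unfolding a_e by (simp add: power2_eq_square)
      then have "norm (a e e) \<le> \<delta> / 7" using small(3) \<rho> by (simp only: pos_divide_le_eq zero_less_power)
      then show ?thesis unfolding norm_mult using c3 by (intro mult_mono) auto
    qed
    moreover have "norm (a v e) \<le> norm (a w e) + norm (c * a e e)"
      unfolding v_eq form_add_left form_scale_left by (rule norm_triangle_ineq)
    ultimately show ?thesis by (simp add: field_simps)
  qed
  with norm_e show ?thesis by blast
qed

text \<open>The rates have to compete: on \<open>V n\<close> the form is degenerate up to \<open>(1/4)^n\<close> in the direction \<open>e n\<close>, while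
  the gliding hump provides a functional of size at least \<open>(1/3)^n / 2\<close> on \<open>e n\<close>. The Galerkin solutions
  would have to grow like \<open>(4/3)^n\<close>, but quasi-optimality keeps them bounded.\<close>

lemma universal_galerkin_imp_essentially_coercive:
  assumes ug: "universal_galerkin sc a"
  shows "essentially_coercive sc a"
  unfolding essentially_coercive_def
proof (intro allI impI, elim conjE, rule ccontr)
  fix u assume "weakly_converges sc u 0" "(\<lambda>n. a (u n) (u n)) \<longlonglongrightarrow> 0"
    "\<not> (\<lambda>n. norm (u n)) \<longlonglongrightarrow> 0"
  note degenerate = almost_degenerate_direction[OF this]
  have "\<exists>e. norm e = 1 \<and>
      (\<forall>v\<in>span (insert e (b ` {..<n})). norm (a v e) \<le> (1/4)^n * norm v)" for n
    by (rule degenerate) simp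
  then obtain e where e: "\<And>n. norm (e n) = 1"
    and small: "\<And>n v. v \<in> span (insert (e n) (b ` {..<n})) \<Longrightarrow> norm (a v (e n)) \<le> (1/4)^n * norm v"
    by metis
  define V where "V n = span (insert (e n) (b ` {..<n}))" for n
  have "approximating_sequence sc V"
    unfolding approximating_sequence_def
  proof (intro conjI allI impI)
    show "fin_dim_subspace sc (V n)" for n unfolding V_def by (simp add: finite_span_fin_dim)
    fix v
    have "infdist v (V n) \<le> infdist v (span (b ` {..<n}))" for n
      unfolding V_def by (rule infdist_mono) (use span_mono span_zero in blast)+
    then show "(\<lambda>n. infdist v (V n)) \<longlonglongrightarrow> 0"
      by (intro tendsto_sandwich[OF _ _ tendsto_const total])
        (auto intro: always_eventually infdist_nonneg)
  qed
  then have "\<exists>n0\<ge>1. \<exists>\<gamma>>0. \<forall>L\<in>antidual sc. \<forall>n\<ge>n0. (\<exists>!w. solves_in a L (V n) w) \<and>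
      (\<forall>u w. solves_in a L UNIV u \<and> solves_in a L (V n) w \<longrightarrow>
        norm (u - w) \<le> \<gamma> * infdist u (V n))"
    using ug unfolding universal_galerkin_def by simp
  then obtain n0 \<gamma> where \<gamma>: "\<gamma> > 0" and galerkin: "\<And>L n. L \<in> antidual sc \<Longrightarrow> n \<ge> n0 \<Longrightarrow>
      (\<exists>!w. solves_in a L (V n) w) \<and> (\<forall>u w. solves_in a L UNIV u \<and> solves_in a L (V n) w \<longrightarrow>
        norm (u - w) \<le> \<gamma> * infdist u (V n))"
    by (elim exE conjE) blast
  obtain y where y: "\<And>n. (1/3)^n / 2 \<le> norm (ip (e n) y)"
    using gliding_hump[of e] e by blast
  have L: "ip y \<in> antidual sc" by (rule ip_right_in_antidual)
  then obtain x where x: "solves_in a (ip y) UNIV x"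
    using ug unfolding universal_galerkin_def by blast
  define K where "K = (1 + \<gamma>) * norm x"
  have le: "(4/3)^n \<le> 2 * K" if "n \<ge> n0" for n
  proof -
    obtain w where w: "solves_in a (ip y) (V n) w" using galerkin[OF L \<open>n \<ge> n0\<close>] by blast
    have "norm (x - w) \<le> \<gamma> * infdist x (V n)" using galerkin[OF L \<open>n \<ge> n0\<close>] x w by blast
    also have "infdist x (V n) \<le> norm x"
      using infdist_le[of 0 "V n" x] span_zero by (simp add: V_def)
    finally have "norm (x - w) \<le> \<gamma> * norm x" using \<gamma> by simp
    then have w_le: "norm w \<le> K"
      using norm_triangle_ineq4[of x "x - w"] by (simp add: K_def distrib_right)
    have "e n \<in> V n" unfolding V_def by (simp add: span_base)
    then have "ip y (e n) = a w (e n)" using w by (simp add: solves_in_def)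
    then have "(1/3)^n / 2 \<le> norm (a w (e n))" using y[of n] by (simp add: norm_ip_commute)
    also have "\<dots> \<le> (1/4)^n * norm w" using w by (intro small) (simp add: solves_in_def V_def)
    also have "\<dots> \<le> (1/4)^n * K" using w_le by (intro mult_left_mono) auto
    finally show ?thesis by (simp add: power_divide field_simps)
  qed
  obtain m where m: "2 * K < (4/3)^m" using real_arch_pow[of "4/3" "2 * K"] by auto
  have "(4/3)^m \<le> (4/3 :: real)^(max m n0)" by (intro power_increasing) auto
  with le[of "max m n0"] m show False by simp
qed

lemma universal_galerkin_imp_uniqueness:
  assumes ug: "universal_galerkin sc a"
  shows "satisfies_uniqueness a"
  unfolding satisfies_uniqueness_def
proof (intro allI impI)
  fix u assume "\<forall>v. a u v = 0"
  then have "solves_in a (\<lambda>_. 0) UNIV u" "solves_in a (\<lambda>_. 0) UNIV 0" by (simp_all add: solves_in_def)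
  moreover have "(\<lambda>_. 0) \<in> antidual sc" by (simp add: antidual_def antilinear_def)
  ultimately show "u = 0" using ug unfolding universal_galerkin_def by blast
qed

end

theorem theorem5p2:
  fixes sc :: "'k::real_or_complex \<Rightarrow> 'v::banach \<Rightarrow> 'v"
    and ip :: "'v \<Rightarrow> 'v \<Rightarrow> 'k"
    and a :: "'v \<Rightarrow> 'v \<Rightarrow> 'k"
  assumes "hilbert_space sc ip"
    and "separable_space (euclidean :: 'v topology)"
    and "\<not> fin_dim_subspace sc UNIV"
    and "sesquilinear sc a"
    and "continuous_form a"
  shows "(essentially_coercive sc a \<and> satisfies_uniqueness a) \<longleftrightarrow> universal_galerkin sc a"
proof -
  obtain b where "separable_hilbert_space sc ip b"
    using hilbert_space.separable_imp_total_orthogonal_sequence[OF assms(1,2)] by blast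
  moreover obtain M where "M > 0" "\<And>u v. norm (a u v) \<le> M * norm u * norm v"
    using assms(5) unfolding continuous_form_def by blast
  ultimately interpret bounded_form sc ip b a M
    using assms(4) by (simp add: bounded_form_def bounded_form_axioms_def)
  show ?thesis
    using essentially_coercive_imp_universal_galerkin universal_galerkin_imp_essentially_coercive
      universal_galerkin_imp_uniqueness by blast
qed

end
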